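(* Let $\widehat f(x)=x^\top\widehat\alpha+\widehat g(x)$, where $$(\widehat\alpha,\widehat g)=\operatorname*{arg\,min}_{\alpha\in\mathbb R^d,\ g\in\mathcal H_K}\Big\{\frac1n\sum_{i=1}^n\big(Y_i-X_i^\top\alpha-g(X_i)\big)^2+\lambda\|g\|_K^2\Big\}$$ is computed from the random-design data described in the context. Assume that $K$ is symmetric, positive semi-definite and continuous, and that the integral operator $L_K$ admits the eigen-decomposition described in the context. Then for any $\lambda>0$, $$\mathcal R(\widehat f-f^* )\ \le\ \inf_{\alpha\in\mathbb R^d,\ f\in\mathcal H_K}\Big\{\mathcal R(\langle\alpha,\cdot\rangle+f-f^* )+\lambda\|f\|_K^2\Big\}+\sigma^2\Big(\frac dn+\frac{R(\lambda)^2}{\lambda}\Big).$$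
   Context: Model and random design: $\mathcal X\subseteq\mathbb R^d$; $(X_i,Y_i)$, $i=1,\dots,n$, are independent, $X_1,\dots,X_n$ are i.i.d. copies of a random vector $X\in\mathcal X$ with distribution $\rho$ satisfying $\mathbb E\|X\|^2<\infty$, and $Y_i=f^*(X_i)+\epsilon_i$ with $f^*:\mathcal X\to\mathbb R$, $\mathbb E[\epsilon_i\mid X_i]=0$ and $\mathbb E[\epsilon_i^2\mid X_i]=\sigma^2$. The design matrix $\mathbb X=(X_1,\dots,X_n)^\top\in\mathbb R^{n\times d}$ has $\operatorname{rank}(\mathbb X)=d$ (almost surely). Kernel: $K:\mathcal X\times\mathcal X\to\mathbb R$ is a kernel function; positive semi-definite means every matrix $(K(x_i,x_j))_{i,j}$ for finitely many points is positive semi-definite. $\mathcal H_K$ is the reproducing kernel Hilbert space of $K$, with norm $\|\cdot\|_K$. Integral operator: $L_K:\mathcal L_2(\rho)\to\mathcal L_2(\rho)$, $L_Kf=\int_{\mathcal X}K(\cdot,x)f(x)\,d\rho(x)$. Eigen-decomposition assumption: there exist eigenvalues $\{\mu_j\}_{j\ge1}$ in non-increasing order (nonnegative, with $\mu_1>0$) and corresponding eigenfunctions $\{\phi_j\}_{j\ge1}$ forming an orthonormal basis of $\mathcal L_2(\rho)$ such that $L_K=\sum_{j=1}^\infty\mu_j\langle\phi_j,\cdot\rangle_\rho\,\phi_j$, where $\langle\cdot,\cdot\rangle_\rho$ is the inner product of $\mathcal L_2(\rho)$. Kernel complexity function: $R(\lambda)=\big(\frac1n\sum_{j=1}^\infty\min\{\lambda,\mu_j\}\big)^{1/2}$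 for $\lambda\ge0$. Risk: for a (possibly data-dependent) measurable function $f:\mathcal X\to\mathbb R$, $\mathcal R(f-f^* )=\frac1n\sum_{i=1}^n\mathbb E[(f(X_i)-f^*(X_i))^2]$; the expectation is over all the data, including the design. $\langle\alpha,\cdot\rangle$ denotes the linear function $x\mapsto x^\top\alpha$. *)

theory Defs
  imports "HOL-Probability.Probability"
begin

section \<open>Kernels and reproducing kernel Hilbert spaces\<close>

definition symmetric_kernel :: "'x set \<Rightarrow> ('x \<Rightarrow> 'x \<Rightarrow> real) \<Rightarrow> bool" where
  "symmetric_kernel S K \<longleftrightarrow> (\<forall>x\<in>S. \<forall>y\<in>S. K x y = K y x)"

definition psd_kernel :: "'x set \<Rightarrow> ('x \<Rightarrow> 'x \<Rightarrow> real) \<Rightarrow> bool" where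
  "psd_kernel S K \<longleftrightarrow>
     (\<forall>(m::nat) (p::nat \<Rightarrow> 'x) (c::nat \<Rightarrow> real). (\<forall>i<m. p i \<in> S) \<longrightarrow>
        (\<Sum>i<m. \<Sum>j<m. c i * c j * K (p i) (p j)) \<ge> 0)"

definition hilbert_norm :: "(('x \<Rightarrow> real) \<Rightarrow> ('x \<Rightarrow> real) \<Rightarrow> real) \<Rightarrow> ('x \<Rightarrow> real) \<Rightarrow> real" where
  "hilbert_norm ip f = sqrt (ip f f)"

text \<open>
  A real function on the set \<open>S\<close> is represented by the total function that is \<open>0\<close> outside \<open>S\<close>.
\<close>

definition kernel_section :: "'x set \<Rightarrow> ('x \<Rightarrow> 'x \<Rightarrow> real) \<Rightarrow> 'x \<Rightarrow> 'x \<Rightarrow> real" where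
  "kernel_section S K x = (\<lambda>y. if y \<in> S then K y x else 0)"

text \<open>
  \<open>H\<close> with the inner product \<open>ip\<close> is a Hilbert space of functions on \<open>S\<close> with reproducing
  kernel \<open>K\<close>. By the Moore--Aronszajn theorem, a symmetric positive semi-definite \<open>K\<close>
  has exactly one such \<open>H\<close>, with \<open>ip\<close> unique on \<open>H\<close>.
\<close>

locale rkhs =
  fixes S :: "'x set"
    and K :: "'x \<Rightarrow> 'x \<Rightarrow> real"
    and H :: "('x \<Rightarrow> real) set"
    and ip :: "('x \<Rightarrow> real) \<Rightarrow> ('x \<Rightarrow> real) \<Rightarrow> real"
  assumes zero_outside: "\<And>f x. f \<in> H \<Longrightarrow> x \<notin> S \<Longrightarrow> f x = 0"
    and zero_mem: "(\<lambda>x. 0) \<in> H"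
    and add_mem: "\<And>f g. f \<in> H \<Longrightarrow> g \<in> H \<Longrightarrow> (\<lambda>x. f x + g x) \<in> H"
    and scale_mem: "\<And>c f. f \<in> H \<Longrightarrow> (\<lambda>x. c * f x) \<in> H"
    and ip_commute: "\<And>f g. f \<in> H \<Longrightarrow> g \<in> H \<Longrightarrow> ip f g = ip g f"
    and ip_add_left: "\<And>f g h. f \<in> H \<Longrightarrow> g \<in> H \<Longrightarrow> h \<in> H \<Longrightarrow>
          ip (\<lambda>x. f x + g x) h = ip f h + ip g h"
    and ip_scale_left: "\<And>c f g. f \<in> H \<Longrightarrow> g \<in> H \<Longrightarrow> ip (\<lambda>x. c * f x) g = c * ip f g"
    and ip_nonneg: "\<And>f. f \<in> H \<Longrightarrow> ip f f \<ge> 0"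
    and ip_definite: "\<And>f. f \<in> H \<Longrightarrow> ip f f = 0 \<Longrightarrow> f = (\<lambda>x. 0)"
    and complete: "\<And>s :: nat \<Rightarrow> 'x \<Rightarrow> real. (\<And>k. s k \<in> H) \<Longrightarrow>
          (\<And>e. e > 0 \<Longrightarrow> \<exists>N. \<forall>k\<ge>N. \<forall>l\<ge>N. hilbert_norm ip (\<lambda>x. s k x - s l x) < e) \<Longrightarrow>
          \<exists>f\<in>H. (\<lambda>k. hilbert_norm ip (\<lambda>x. s k x - f x)) \<longlonglongrightarrow> 0"
    and section_mem: "\<And>x. x \<in> S \<Longrightarrow> kernel_section S K x \<in> H"
    and reproducing: "\<And>f x. f \<in> H \<Longrightarrow> x \<in> S \<Longrightarrow> ip f (kernel_section S K x) = f x"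

section \<open>The integral operator and its eigen-decomposition\<close>

text \<open>
  Elements of the space \<open>L\<^sub>2\<close> are represented by functions; equality in \<open>L\<^sub>2\<close> is equality
  almost everywhere.
\<close>

definition L2_functions :: "'x measure \<Rightarrow> ('x \<Rightarrow> real) set" where
  "L2_functions \<rho> = {f \<in> borel_measurable \<rho>. integrable \<rho> (\<lambda>x. (f x)\<^sup>2)}"

definition L2_inner :: "'x measure \<Rightarrow> ('x \<Rightarrow> real) \<Rightarrow> ('x \<Rightarrow> real) \<Rightarrow> real" where
  "L2_inner \<rho> f g = (\<integral>x. f x * g x \<partial>\<rho>)"

definition L2_norm :: "'x measure \<Rightarrow> ('x \<Rightarrow> real) \<Rightarrow> real" where
  "L2_norm \<rho> f = sqrt (L2_inner \<rho> f f)"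

definition L2_sums :: "'x measure \<Rightarrow> (nat \<Rightarrow> 'x \<Rightarrow> real) \<Rightarrow> ('x \<Rightarrow> real) \<Rightarrow> bool" where
  "L2_sums \<rho> u f \<longleftrightarrow> (\<lambda>N. L2_norm \<rho> (\<lambda>x. f x - (\<Sum>j<N. u j x))) \<longlonglongrightarrow> 0"

definition L2_orthonormal_basis :: "'x measure \<Rightarrow> (nat \<Rightarrow> 'x \<Rightarrow> real) \<Rightarrow> bool" where
  "L2_orthonormal_basis \<rho> \<phi> \<longleftrightarrow>
     (\<forall>j. \<phi> j \<in> L2_functions \<rho>) \<and>
     (\<forall>i j. L2_inner \<rho> (\<phi> i) (\<phi> j) = (if i = j then 1 else 0)) \<and>
     (\<forall>f\<in>L2_functions \<rho>. L2_sums \<rho> (\<lambda>j x. L2_inner \<rho> (\<phi> j) f * \<phi> j x) f)"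

definition integral_operator ::
    "'x measure \<Rightarrow> ('x \<Rightarrow> 'x \<Rightarrow> real) \<Rightarrow> ('x \<Rightarrow> real) \<Rightarrow> 'x \<Rightarrow> real" where
  "integral_operator \<rho> K f = (\<lambda>y. \<integral>x. K y x * f x \<partial>\<rho>)"

text \<open>
  The Bochner integral of a non-integrable function is \<open>0\<close>, so the existence of the integrals
  has to be required.
\<close>

definition L2_operator :: "'x measure \<Rightarrow> ('x \<Rightarrow> 'x \<Rightarrow> real) \<Rightarrow> bool" where
  "L2_operator \<rho> K \<longleftrightarrow>
     (\<forall>f\<in>L2_functions \<rho>. (AE y in \<rho>. integrable \<rho> (\<lambda>x. K y x * f x)) \<and>
        integral_operator \<rho> K f \<in> L2_functions \<rho>)"

text \<open>Indices start at \<open>0\<close>, so \<open>\<mu> 0\<close> is the largest eigenvalue.\<close>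

definition eigen_decomposition ::
    "'x measure \<Rightarrow> ('x \<Rightarrow> 'x \<Rightarrow> real) \<Rightarrow> (nat \<Rightarrow> real) \<Rightarrow> (nat \<Rightarrow> 'x \<Rightarrow> real) \<Rightarrow> bool" where
  "eigen_decomposition \<rho> K \<mu> \<phi> \<longleftrightarrow>
     L2_operator \<rho> K \<and>
     decseq \<mu> \<and> (\<forall>j. \<mu> j \<ge> 0) \<and> \<mu> 0 > 0 \<and>
     L2_orthonormal_basis \<rho> \<phi> \<and>
     (\<forall>f\<in>L2_functions \<rho>.
        L2_sums \<rho> (\<lambda>j x. \<mu> j * L2_inner \<rho> (\<phi> j) f * \<phi> j x) (integral_operator \<rho> K f))"

text \<open>
  The series may diverge, so the kernel complexity function takes values in the extended
  nonnegative reals.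
\<close>

definition ennreal_sqrt :: "ennreal \<Rightarrow> ennreal" where
  "ennreal_sqrt t = (if t = \<top> then \<top> else ennreal (sqrt (enn2real t)))"

definition kernel_complexity :: "nat \<Rightarrow> (nat \<Rightarrow> real) \<Rightarrow> real \<Rightarrow> ennreal" where
  "kernel_complexity n \<mu> l =
     ennreal_sqrt (ennreal (1 / real n) * (\<Sum>j. ennreal (min l (\<mu> j))))"

section \<open>Random design model, risk and estimator\<close>

text \<open>
  The sample is indexed by the finite type \<open>'n\<close>, so the sample size is \<open>CARD('n)\<close>. The Borel
  sigma-algebra of the subspace \<open>S\<close> is \<open>restrict_space borel S\<close>, also if \<open>S\<close> is not a Borel set.
\<close>

locale random_design = prob_space M
  for M :: "'w measure" +
  fixes S :: "(real^'d) set"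
    and \<rho> :: "(real^'d) measure"
    and fstar :: "real^'d \<Rightarrow> real"
    and \<sigma> :: real
    and X :: "'n::finite \<Rightarrow> 'w \<Rightarrow> real^'d"
    and Y :: "'n \<Rightarrow> 'w \<Rightarrow> real"
    and \<epsilon> :: "'n \<Rightarrow> 'w \<Rightarrow> real"
  assumes X_measurable: "\<And>i. X i \<in> measurable M (restrict_space borel S)"
    and X_distr: "\<And>i. distr M (restrict_space borel S) (X i) = \<rho>"
    and X_second_moment: "integrable \<rho> (\<lambda>x. (norm x)\<^sup>2)"
    and fstar_measurable: "fstar \<in> borel_measurable \<rho>"
    and regression: "\<And>i w. w \<in> space M \<Longrightarrow> Y i w = fstar (X i w) + \<epsilon> i w"
    and indep: "indep_vars (\<lambda>_. borel) (\<lambda>i w. (X i w, Y i w)) UNIV"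
    and noise_square_integrable: "\<And>i. integrable M (\<lambda>w. (\<epsilon> i w)\<^sup>2)"
    and noise_cond_mean: "\<And>i. AE w in M.
          real_cond_exp M (vimage_algebra (space M) (X i) borel) (\<epsilon> i) w = 0"
    and noise_cond_variance: "\<And>i. AE w in M.
          real_cond_exp M (vimage_algebra (space M) (X i) borel) (\<lambda>w. (\<epsilon> i w)\<^sup>2) w = \<sigma>\<^sup>2"
    and full_rank: "AE w in M. rank ((\<chi> i. X i w) :: real^'d^'n) = CARD('d)"

text \<open>The risk of a data-dependent function \<open>h\<close>, with values in the extended nonnegative reals.\<close>

definition risk ::
    "'w measure \<Rightarrow> ('n::finite \<Rightarrow> 'w \<Rightarrow> real^'d) \<Rightarrow> ('w \<Rightarrow> real^'d \<Rightarrow> real) \<Rightarrow> ennreal" where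
  "risk M X h = ennreal (1 / real CARD('n)) * (\<Sum>i\<in>UNIV. \<integral>\<^sup>+ w. ennreal ((h w (X i w))\<^sup>2) \<partial>M)"

definition penalized_loss ::
    "((real^'d \<Rightarrow> real) \<Rightarrow> (real^'d \<Rightarrow> real) \<Rightarrow> real) \<Rightarrow> real \<Rightarrow> ('n::finite \<Rightarrow> real^'d) \<Rightarrow>
     ('n \<Rightarrow> real) \<Rightarrow> (real^'d) \<times> (real^'d \<Rightarrow> real) \<Rightarrow> real" where
  "penalized_loss ip l x y = (\<lambda>(\<alpha>, g).
     (1 / real CARD('n)) * (\<Sum>i\<in>UNIV. (y i - x i \<bullet> \<alpha> - g (x i))\<^sup>2) + l * (hilbert_norm ip g)\<^sup>2)"

end

theory Submission
  imports Defs
begin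

text \<open>
  Fix the design \<open>x\<close>, let \<open>n\<close> be the sample size and put \<open>c = n * lam\<close>. The fit is linear in the
  responses: the residuals of the minimizer for data \<open>y\<close> are \<open>B y\<close> for a matrix \<open>B\<close> (\<open>residual_matrix\<close>),
  so the fitted values are \<open>A y\<close> with the smoother \<open>A = I - B\<close>. Since \<open>Y = f* + \<epsilon>\<close> on the sample, the error
  at the design points is \<open>A \<epsilon> - B f*\<close>. The noise has conditional mean \<open>0\<close> and variance \<open>\<sigma>\<^sup>2\<close> given the
  whole design, so the cross terms vanish, and the expected squared error is that of the bias \<open>B f*\<close> plus
  \<open>\<sigma>\<^sup>2\<close> times the expected squared Frobenius norm of \<open>A\<close> (\<open>nn_integral_smoother_square\<close>).

  The bias needs no computation. The vector \<open>B f*\<close> is the residual of the penalized fit to the noiseless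
  data \<open>f*\<close>, and the squared residual is at most the minimal penalized loss, hence at most the loss of
  any competitor \<open>(\<alpha>, f)\<close> (\<open>residual_norm_le_loss\<close>).

  For the variance, \<open>0 \<le> A \<le> I\<close> bounds the Frobenius norm by the trace of \<open>A\<close>. The diagonal entry \<open>B k k\<close>
  is the minimal loss for the data \<open>axis k 1\<close>, so a lower bound on losses is an upper bound on the trace.
  If the Gram matrix is a sum of rank one matrices \<open>u j * (u j)^T\<close>, then the first \<open>N\<close> of the vectors \<open>u j\<close>, just like
  the \<open>d\<close> columns of the design, cost one unit of trace each, and the others cost at most
  \<open>(norm (u j))\<^sup>2 / c\<close> (\<open>trace_residual_lower_bound\<close>).

  It remains to write the Gram matrix as such a sum with vectors of known expected length. Mercer's
  expansion would give \<open>u j\<close> as \<open>sqrt (\<mu> j)\<close> times the values of \<open>\<phi> j\<close>, but the eigen-decomposition holds in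
  \<open>L\<^sub>2\<close> only and says nothing about \<open>K\<close> on the diagonal. Averages over small dyadic cubes avoid this point:
  the average of \<open>K\<close> over the product of the cells of two points is \<open>\<Sum>j. \<mu> j * a j * b j\<close>, where \<open>a j\<close> and \<open>b j\<close>
  are the averages of \<open>\<phi> j\<close> over the two cells (\<open>kernel_cell_average_series\<close>), and by continuity it
  converges to \<open>K\<close> when the cells shrink (\<open>kernel_cell_average_tendsto\<close>). Averaging is a contraction of
  \<open>L\<^sub>2\<close> (\<open>cell_average_contraction\<close>), so the averaged \<open>\<phi> j\<close> has mean square at most \<open>1\<close>. Fatou's lemma then
  bounds the expected trace by \<open>d + N + (\<Sum>j\<ge>N. \<mu> j) / lam\<close>. Taking for \<open>N\<close> the number of eigenvalues above
  \<open>lam\<close>, this is \<open>d + (\<Sum>j. min lam (\<mu> j)) / lam\<close> (\<open>expected_trace_le\<close>); divided by \<open>n\<close>, it is \<open>d / n\<close> plus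
  the complexity term.
\<close>

section \<open>Orthogonal projections and traces\<close>

lemma bessel_inequality:
  fixes Q :: "'a::euclidean_space set"
  assumes "pairwise orthogonal Q" "\<And>q. q \<in> Q \<Longrightarrow> norm q = 1"
  shows "(\<Sum>q\<in>Q. (q \<bullet> z)\<^sup>2) \<le> (norm z)\<^sup>2"
    and "(norm (\<Sum>q\<in>Q. (q \<bullet> z) *\<^sub>R q))\<^sup>2 = (\<Sum>q\<in>Q. (q \<bullet> z)\<^sup>2)"
proof -
  have "finite Q"
    using assms by (meson pairwise_orthogonal_imp_finite)
  have orth: "q \<bullet> p = (if q = p then 1 else 0)" if "q \<in> Q" "p \<in> Q" for p q
    using assms that by (auto simp: pairwise_def orthogonal_def norm_eq_1)
  let ?p = "\<Sum>q\<in>Q. (q \<bullet> z) *\<^sub>R q"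
  have "?p \<bullet> ?p = (\<Sum>q\<in>Q. \<Sum>p\<in>Q. (q \<bullet> z) * ((p \<bullet> z) * (q \<bullet> p)))"
    by (simp add: inner_sum_left inner_sum_right sum_distrib_left inner_commute mult_ac)
  also have "\<dots> = (\<Sum>q\<in>Q. (q \<bullet> z)\<^sup>2)"
    by (intro sum.cong refl) (simp add: orth \<open>finite Q\<close> power2_eq_square sum.delta if_distrib mult_ac cong: if_cong)
  finally have pp: "?p \<bullet> ?p = (\<Sum>q\<in>Q. (q \<bullet> z)\<^sup>2)" .
  have pz: "?p \<bullet> z = (\<Sum>q\<in>Q. (q \<bullet> z)\<^sup>2)"
    by (simp add: inner_sum_left power2_eq_square)
  have "0 \<le> (z - ?p) \<bullet> (z - ?p)" by simp
  also have "\<dots> = z \<bullet> z - (\<Sum>q\<in>Q. (q \<bullet> z)\<^sup>2)"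
    using pp pz by (simp add: inner_diff_left inner_diff_right inner_commute)
  finally show "(\<Sum>q\<in>Q. (q \<bullet> z)\<^sup>2) \<le> (norm z)\<^sup>2"
    by (simp add: power2_norm_eq_inner)
  show "(norm ?p)\<^sup>2 = (\<Sum>q\<in>Q. (q \<bullet> z)\<^sup>2)"
    using pp by (simp add: power2_norm_eq_inner)
qed

lemma orthonormal_complement:
  fixes T :: "(real^'n) set"
  assumes "finite T"
  obtains Q where "pairwise orthogonal Q" "\<And>q. q \<in> Q \<Longrightarrow> norm q = 1"
    "\<And>q v. q \<in> Q \<Longrightarrow> v \<in> span T \<Longrightarrow> q \<bullet> v = 0"
    "CARD('n) \<le> card T + card Q" "finite Q"
proof -
  let ?W = "{y. \<forall>x\<in>span T. orthogonal x y}"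
  obtain Q where Q: "Q \<subseteq> ?W" "pairwise orthogonal Q" "\<And>q. q \<in> Q \<Longrightarrow> norm q = 1"
      "independent Q" "card Q = dim ?W"
    using orthonormal_basis_subspace[of ?W] subspace_orthogonal_to_vectors[of "span T"]
    by (metis (no_types, lifting))
  have "dim ?W + dim (span T) = dim (UNIV :: (real^'n) set)"
    using dim_subspace_orthogonal_to_vectors[of "span T" "UNIV :: (real^'n) set"] by simp
  then have "CARD('n) = dim T + card Q"
    using Q(5) by (simp add: dim_UNIV)
  moreover have "dim T \<le> card T"
    using assms by (rule dim_le_card')
  moreover have "q \<bullet> v = 0" if "q \<in> Q" "v \<in> span T" for q v
    using that Q(1) by (auto simp: orthogonal_def inner_commute)
  ultimately show ?thesis
    using that[of Q] Q pairwise_orthogonal_imp_finite by fastforce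
qed

text \<open>
  Projecting onto the orthogonal complement of \<open>span T\<close> removes the vectors \<open>v k\<close>. What remains of
  \<open>axis k 1\<close> has total squared length equal to the dimension of the complement, since this sum is the
  trace of the projection. The penalty \<open>c * (t k j)\<^sup>2\<close> limits by how much the vectors \<open>u j\<close> can reduce it.
\<close>

lemma trace_residual_lower_bound:
  fixes u :: "'j \<Rightarrow> real^'n" and v :: "'n \<Rightarrow> real^'n" and t :: "'n \<Rightarrow> 'j \<Rightarrow> real"
  assumes T: "finite T" "\<And>k. v k \<in> span T" and c: "c > 0"
  shows "real CARD('n) \<le> real (card T) + (\<Sum>j\<in>J. (norm (u j))\<^sup>2) / c
    + (\<Sum>k\<in>UNIV. (norm (axis k 1 - v k - (\<Sum>j\<in>J. t k j *\<^sub>R u j)))\<^sup>2 + c * (\<Sum>j\<in>J. (t k j)\<^sup>2))"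
proof -
  obtain Q where Q: "pairwise orthogonal Q" "\<And>q. q \<in> Q \<Longrightarrow> norm q = 1"
    "\<And>q v. q \<in> Q \<Longrightarrow> v \<in> span T \<Longrightarrow> q \<bullet> v = 0"
    "CARD('n) \<le> card T + card Q" "finite Q"
    using orthonormal_complement[OF T(1)] by metis
  \<comment> \<open>The vector \<open>\<lambda>k. w j k\<close> is the projection of \<open>u j\<close> onto the span of \<open>Q\<close>.\<close>
  define w where "w j k = (\<Sum>q\<in>Q. (q \<bullet> u j) * q $ k)" for j k
  have col: "(\<Sum>q\<in>Q. (q $ k)\<^sup>2) - (\<Sum>j\<in>J. (w j k)\<^sup>2) / c
    \<le> (norm (axis k 1 - v k - (\<Sum>j\<in>J. t k j *\<^sub>R u j)))\<^sup>2 + c * (\<Sum>j\<in>J. (t k j)\<^sup>2)" for k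
  proof -
    let ?z = "axis k 1 - v k - (\<Sum>j\<in>J. t k j *\<^sub>R u j)"
    have qz: "q \<bullet> ?z = q $ k - (\<Sum>j\<in>J. t k j * (q \<bullet> u j))" if "q \<in> Q" for q
      using Q(3)[OF that T(2)] by (simp add: inner_diff_right inner_sum_right inner_axis)
    have "(\<Sum>q\<in>Q. (q $ k)\<^sup>2) - 2 * (\<Sum>j\<in>J. t k j * w j k)
      = (\<Sum>q\<in>Q. (q $ k)\<^sup>2 - 2 * (q $ k) * (\<Sum>j\<in>J. t k j * (q \<bullet> u j)))"
      unfolding w_def sum_subtractf sum_distrib_left
      by (subst sum.swap) (simp add: mult_ac)
    also have "\<dots> \<le> (\<Sum>q\<in>Q. (q \<bullet> ?z)\<^sup>2)"
      by (intro sum_mono) (simp add: qz power2_diff)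
    also have "\<dots> \<le> (norm ?z)\<^sup>2"
      using Q by (intro bessel_inequality) auto
    finally have 1: "(\<Sum>q\<in>Q. (q $ k)\<^sup>2) - 2 * (\<Sum>j\<in>J. t k j * w j k) \<le> (norm ?z)\<^sup>2" .
    have "2 * (s * r) \<le> r\<^sup>2 / c + c * s\<^sup>2" for s r :: real
    proof -
      have "0 \<le> (r - c * s)\<^sup>2 / c" using c by simp
      also have "\<dots> = r\<^sup>2 / c + c * s\<^sup>2 - 2 * (s * r)"
        using c by (simp add: power2_eq_square field_simps)
      finally show ?thesis by simp
    qed
    then have "(\<Sum>j\<in>J. 2 * (t k j * w j k)) \<le> (\<Sum>j\<in>J. (w j k)\<^sup>2 / c + c * (t k j)\<^sup>2)"
      by (intro sum_mono)
    then have "2 * (\<Sum>j\<in>J. t k j * w j k) \<le> (\<Sum>j\<in>J. (w j k)\<^sup>2) / c + c * (\<Sum>j\<in>J. (t k j)\<^sup>2)"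
      by (simp add: sum.distrib sum_distrib_left sum_divide_distrib)
    with 1 show ?thesis by simp
  qed
  have "(\<Sum>k\<in>UNIV. \<Sum>q\<in>Q. (q $ k)\<^sup>2) = (\<Sum>q\<in>Q. (norm q)\<^sup>2)"
    by (subst sum.swap) (simp only: power2_norm_eq_inner, simp add: inner_vec_def power2_eq_square)
  also have "\<dots> = card Q" using Q(2) by simp
  finally have trace: "(\<Sum>k\<in>UNIV. \<Sum>q\<in>Q. (q $ k)\<^sup>2) = card Q" .
  have "(\<Sum>k\<in>UNIV. (w j k)\<^sup>2) \<le> (norm (u j))\<^sup>2" for j
  proof -
    have "(\<Sum>k\<in>UNIV. (w j k)\<^sup>2) = (norm (\<Sum>q\<in>Q. (q \<bullet> u j) *\<^sub>R q))\<^sup>2"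
      by (simp only: power2_norm_eq_inner w_def) (simp add: inner_vec_def[where x="sum f Q" for f] power2_eq_square)
    then show ?thesis
      using bessel_inequality[OF Q(1,2), where z="u j"] by simp
  qed
  then have "(\<Sum>k\<in>UNIV. \<Sum>j\<in>J. (w j k)\<^sup>2) \<le> (\<Sum>j\<in>J. (norm (u j))\<^sup>2)"
    by (subst sum.swap) (intro sum_mono)
  then have "(\<Sum>k\<in>UNIV. (\<Sum>j\<in>J. (w j k)\<^sup>2) / c) \<le> (\<Sum>j\<in>J. (norm (u j))\<^sup>2) / c"
    using c by (simp add: sum_divide_distrib[symmetric] divide_right_mono)
  moreover have "(\<Sum>k\<in>UNIV. (\<Sum>q\<in>Q. (q $ k)\<^sup>2) - (\<Sum>j\<in>J. (w j k)\<^sup>2) / c) \<le>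
    (\<Sum>k\<in>UNIV. (norm (axis k 1 - v k - (\<Sum>j\<in>J. t k j *\<^sub>R u j)))\<^sup>2 + c * (\<Sum>j\<in>J. (t k j)\<^sup>2))"
    by (intro sum_mono col)
  moreover have "(\<Sum>k\<in>UNIV. (\<Sum>q\<in>Q. (q $ k)\<^sup>2) - (\<Sum>j\<in>J. (w j k)\<^sup>2) / c)
      = card Q - (\<Sum>k\<in>UNIV. (\<Sum>j\<in>J. (w j k)\<^sup>2) / c)"
    by (simp add: sum_subtractf trace)
  ultimately show ?thesis using Q(4) by linarith
qed

section \<open>Penalized least squares at a fixed design\<close>

lemma sum_UNIV_sum_type:
  "(\<Sum>p\<in>UNIV. f p) = (\<Sum>i\<in>UNIV. f (Inl i)) + (\<Sum>j\<in>UNIV. f (Inr j))"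
  for f :: "'a::finite + 'b::finite \<Rightarrow> 'c::comm_monoid_add"
  unfolding UNIV_Plus_UNIV[symmetric] by (subst sum.Plus) (simp_all del: UNIV_Plus_UNIV)

text \<open>
  The coefficient matrix of the first order conditions for the penalized fit. The unknowns are the
  residuals (components \<open>Inl\<close>) and the linear coefficient (components \<open>Inr\<close>). The function part of the fit
  is \<open>(\<Sum>k. r k * K (x k)) / c\<close> for the residuals \<open>r\<close>, and \<open>r\<close> is orthogonal to the columns of the design.
\<close>

definition saddle_matrix ::
    "real \<Rightarrow> (real^'d \<Rightarrow> real^'d \<Rightarrow> real) \<Rightarrow> ('n::finite \<Rightarrow> real^'d) \<Rightarrow> real^('n + 'd)^('n + 'd)" where
  "saddle_matrix c K x = (\<chi> p q. case p of
      Inl i \<Rightarrow> (case q of Inl k \<Rightarrow> (if i = k then 1 else 0) + K (x i) (x k) / c | Inr j \<Rightarrow> x i $ j)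
    | Inr j \<Rightarrow> (case q of Inl i \<Rightarrow> x i $ j | Inr j' \<Rightarrow> 0))"

lemma saddle_matrix_mult:
  "(saddle_matrix c K x *v z) $ Inl i =
     z $ Inl i + (\<Sum>k\<in>UNIV. K (x i) (x k) * z $ Inl k) / c + x i \<bullet> (\<chi> j. z $ Inr j)"
  "(saddle_matrix c K x *v z) $ Inr j = (\<Sum>i\<in>UNIV. x i $ j * z $ Inl i)"
proof -
  have "(saddle_matrix c K x *v z) $ Inl i =
      (\<Sum>k\<in>UNIV. ((if i = k then 1 else 0) + K (x i) (x k) / c) * z $ Inl k) + (\<Sum>j\<in>UNIV. x i $ j * z $ Inr j)"
    by (simp only: saddle_matrix_def matrix_vector_mult_def sum_UNIV_sum_type vec_lambda_beta sum.case)
  also have "(\<Sum>k\<in>UNIV. ((if i = k then 1 else 0) + K (x i) (x k) / c) * z $ Inl k)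
      = (\<Sum>k\<in>UNIV. (if i = k then z $ Inl k else 0) + K (x i) (x k) * z $ Inl k / c)"
    by (intro sum.cong refl) (simp add: distrib_right)
  also have "\<dots> = z $ Inl i + (\<Sum>k\<in>UNIV. K (x i) (x k) * z $ Inl k) / c"
    by (simp add: sum.distrib sum_divide_distrib)
  also have "(\<Sum>j\<in>UNIV. x i $ j * z $ Inr j) = x i \<bullet> (\<chi> j. z $ Inr j)"
    by (simp add: inner_vec_def)
  finally show "(saddle_matrix c K x *v z) $ Inl i =
     z $ Inl i + (\<Sum>k\<in>UNIV. K (x i) (x k) * z $ Inl k) / c + x i \<bullet> (\<chi> j. z $ Inr j)" .
  show "(saddle_matrix c K x *v z) $ Inr j = (\<Sum>i\<in>UNIV. x i $ j * z $ Inl i)"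
    by (simp add: saddle_matrix_def matrix_vector_mult_def sum_UNIV_sum_type)
qed

lemma sum_inner_design:
  fixes x :: "'n::finite \<Rightarrow> real^'d"
  assumes "\<And>j. (\<Sum>i\<in>UNIV. x i $ j * r i) = 0"
  shows "(\<Sum>i\<in>UNIV. r i * (x i \<bullet> \<alpha>)) = 0"
proof -
  have "(\<Sum>i\<in>UNIV. r i * (x i \<bullet> \<alpha>)) = (\<Sum>j\<in>UNIV. \<alpha> $ j * (\<Sum>i\<in>UNIV. x i $ j * r i))"
    by (simp add: inner_vec_def sum_distrib_left mult_ac) (rule sum.swap)
  then show ?thesis by (simp add: assms)
qed

text \<open>
  Testing the first block of the homogeneous system with \<open>r\<close> gives \<open>\<bar>r\<bar>\<^sup>2 + r^T G r / c = 0\<close>, since \<open>r\<close> is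
  orthogonal to the design; so \<open>r = 0\<close>, and the rank condition removes the linear part.
\<close>

lemma det_saddle_matrix_nonzero:
  fixes x :: "'n::finite \<Rightarrow> real^'d"
  assumes c: "c > 0"
    and psd: "\<And>a. (\<Sum>i\<in>UNIV. \<Sum>k\<in>UNIV. a i * a k * K (x i) (x k)) \<ge> 0"
    and rank: "rank ((\<chi> i. x i) :: real^'d^'n) = CARD('d)"
  shows "det (saddle_matrix c K x) \<noteq> 0"
proof -
  have "z = 0" if z: "saddle_matrix c K x *v z = 0" for z
  proof -
    define r where "r i = z $ Inl i" for i
    define \<alpha> where "\<alpha> = (\<chi> j. z $ Inr j)"
    have eq1: "r i + (\<Sum>k\<in>UNIV. K (x i) (x k) * r k) / c + x i \<bullet> \<alpha> = 0" for i
      using arg_cong[OF z, of "\<lambda>v. v $ Inl i"] by (simp add: saddle_matrix_mult r_def \<alpha>_def)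
    have eq2: "(\<Sum>i\<in>UNIV. x i $ j * r i) = 0" for j
      using arg_cong[OF z, of "\<lambda>v. v $ Inr j"] by (simp add: saddle_matrix_mult r_def)
    have "0 = (\<Sum>i\<in>UNIV. r i * (r i + (\<Sum>k\<in>UNIV. K (x i) (x k) * r k) / c + x i \<bullet> \<alpha>))"
      by (simp add: eq1)
    also have "\<dots> = (\<Sum>i\<in>UNIV. (r i)\<^sup>2) + (\<Sum>i\<in>UNIV. \<Sum>k\<in>UNIV. r i * r k * K (x i) (x k)) / c
        + (\<Sum>i\<in>UNIV. r i * (x i \<bullet> \<alpha>))"
      by (simp add: distrib_left sum.distrib sum_divide_distrib sum_distrib_left power2_eq_square mult_ac)
    finally have "(\<Sum>i\<in>UNIV. (r i)\<^sup>2) \<le> 0"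
      using divide_nonneg_pos[OF psd[of r] c] sum_inner_design[OF eq2, where \<alpha>=\<alpha>] by linarith
    then have "(\<Sum>i\<in>UNIV. (r i)\<^sup>2) = 0"
      by (simp add: antisym sum_nonneg)
    then have r: "r i = 0" for i
      by (simp add: sum_nonneg_eq_0_iff)
    have "((\<chi> i. x i) :: real^'d^'n) *v \<alpha> = ((\<chi> i. x i) :: real^'d^'n) *v 0"
      using eq1 by (simp add: vec_eq_iff matrix_vector_mul_component r)
    then have "\<alpha> = 0"
      using rank full_rank_injective[of "(\<chi> i. x i) :: real^'d^'n"] by (simp add: inj_def)
    then have "z $ Inr j = 0" for j
      by (simp add: \<alpha>_def vec_eq_iff)
    then have "z $ p = 0" for p
      using r by (cases p) (auto simp: r_def)
    then show ?thesis by (simp add: vec_eq_iff)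
  qed
  then have "invertible (saddle_matrix c K x)"
    using matrix_left_invertible_ker invertible_left_inverse by blast
  then show ?thesis by (simp add: invertible_det_nz)
qed

text \<open>
  Column \<open>k\<close> consists of the residuals for the data \<open>axis k 1\<close>, given by Cramer's rule if the determinant is nonzero. This formula makes the
  entries measurable functions of the design.
\<close>

definition residual_matrix ::
    "real \<Rightarrow> (real^'d \<Rightarrow> real^'d \<Rightarrow> real) \<Rightarrow> ('n::finite \<Rightarrow> real^'d) \<Rightarrow> 'n \<Rightarrow> 'n \<Rightarrow> real" where
  "residual_matrix c K x i k =
     det (\<chi> p q. if q = Inl i then (if p = Inl k then 1 else 0) else saddle_matrix c K x $ p $ q)
       / det (saddle_matrix c K x)"

definition residual ::
    "real \<Rightarrow> (real^'d \<Rightarrow> real^'d \<Rightarrow> real) \<Rightarrow> ('n::finite \<Rightarrow> real^'d) \<Rightarrow> ('n \<Rightarrow> real) \<Rightarrow> 'n \<Rightarrow> real" where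
  "residual c K x y i = (\<Sum>k\<in>UNIV. residual_matrix c K x i k * y k)"

lemma residual_indicator: "residual c K x (\<lambda>i. if i = k then 1 else 0) i = residual_matrix c K x i k"
  by (simp add: residual_def if_distrib cong: if_cong)

lemma residual_add: "residual c K x (\<lambda>i. y i + z i) i = residual c K x y i + residual c K x z i"
  by (simp add: residual_def distrib_left sum.distrib)

lemma residual_equations:
  fixes x :: "'n::finite \<Rightarrow> real^'d"
  assumes "det (saddle_matrix c K x) \<noteq> 0"
  obtains \<alpha> where
    "\<And>i. residual c K x y i + (\<Sum>k\<in>UNIV. K (x i) (x k) * residual c K x y k) / c + x i \<bullet> \<alpha> = y i"
    "\<And>j. (\<Sum>i\<in>UNIV. x i $ j * residual c K x y i) = 0"
proof -
  let ?Z = "saddle_matrix c K x"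
  define b :: "real^('n + 'd)" where "b = (\<chi> p. case p of Inl i \<Rightarrow> y i | Inr j \<Rightarrow> 0)"
  define e :: "'n \<Rightarrow> real^('n + 'd)" where "e k = (\<chi> p. if p = Inl k then 1 else 0)" for k
  define s where "s k = (\<chi> q. det (\<chi> p q'. if q' = q then e k $ p else ?Z $ p $ q') / det ?Z)" for k
  have s: "?Z *v s k = e k" for k
    using cramer[OF assms] by (simp add: s_def)
  define z where "z = (\<Sum>k\<in>UNIV. y k *\<^sub>R s k)"
  have "?Z *v z = (\<Sum>k\<in>UNIV. y k *\<^sub>R e k)"
    by (simp add: z_def linear_sum[OF matrix_vector_mul_linear] matrix_vector_mult_scaleR s)
  also have "\<dots> = b"
    by (auto simp: vec_eq_iff b_def e_def if_distrib split: sum.split cong: if_cong)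
  finally have z: "?Z *v z = b" .
  have r: "z $ Inl i = residual c K x y i" for i
    by (simp add: z_def s_def e_def residual_def residual_matrix_def mult_ac cong: if_cong)
  show ?thesis
  proof (rule that)
    show "residual c K x y i + (\<Sum>k\<in>UNIV. K (x i) (x k) * residual c K x y k) / c
        + x i \<bullet> (\<chi> j. z $ Inr j) = y i" for i
      using arg_cong[OF z, of "\<lambda>v. v $ Inl i"] by (simp add: saddle_matrix_mult r b_def)
    show "(\<Sum>i\<in>UNIV. x i $ j * residual c K x y i) = 0" for j
      using arg_cong[OF z, of "\<lambda>v. v $ Inr j"] by (simp add: saddle_matrix_mult r b_def)
  qed
qed

context rkhs
begin

lemma sum_mem: "finite I \<Longrightarrow> (\<And>i. i \<in> I \<Longrightarrow> f i \<in> H) \<Longrightarrow> (\<lambda>x. \<Sum>i\<in>I. f i x) \<in> H"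
  by (induction I rule: finite_induct) (auto simp: zero_mem intro: add_mem)

lemma diff_mem: "f \<in> H \<Longrightarrow> g \<in> H \<Longrightarrow> (\<lambda>x. f x - g x) \<in> H"
  using add_mem[of f "\<lambda>x. (-1) * g x"] scale_mem[of g "-1"] by simp

lemma ip_zero_left: "g \<in> H \<Longrightarrow> ip (\<lambda>x. 0) g = 0"
  using ip_scale_left[of "\<lambda>x. 0" g 0] zero_mem by simp

lemma ip_sum_left:
  "finite I \<Longrightarrow> (\<And>i. i \<in> I \<Longrightarrow> f i \<in> H) \<Longrightarrow> g \<in> H \<Longrightarrow>
    ip (\<lambda>x. \<Sum>i\<in>I. f i x) g = (\<Sum>i\<in>I. ip (f i) g)"
  by (induction I rule: finite_induct) (auto simp: ip_zero_left ip_add_left sum_mem)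

lemma ip_diff_left: "f \<in> H \<Longrightarrow> g \<in> H \<Longrightarrow> h \<in> H \<Longrightarrow> ip (\<lambda>x. f x - g x) h = ip f h - ip g h"
  using ip_add_left[of f "\<lambda>x. (-1) * g x" h] ip_scale_left[of g h "-1"] scale_mem[of g "-1"] by simp

lemma hilbert_norm_square: "f \<in> H \<Longrightarrow> (hilbert_norm ip f)\<^sup>2 = ip f f"
  by (simp add: hilbert_norm_def ip_nonneg)

definition kernel_combination :: "('n::finite \<Rightarrow> real) \<Rightarrow> ('n \<Rightarrow> 'x) \<Rightarrow> 'x \<Rightarrow> real" where
  "kernel_combination a x = (\<lambda>y. \<Sum>i\<in>UNIV. a i * kernel_section S K (x i) y)"

lemma kernel_combination:
  assumes "\<And>i. x i \<in> S"
  shows "kernel_combination a x \<in> H"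
    and "h \<in> H \<Longrightarrow> ip (kernel_combination a x) h = (\<Sum>i\<in>UNIV. a i * h (x i))"
    and "z \<in> S \<Longrightarrow> kernel_combination a x z = (\<Sum>k\<in>UNIV. a k * K z (x k))"
    and "ip (kernel_combination a x) (kernel_combination a x) =
      (\<Sum>i\<in>UNIV. \<Sum>k\<in>UNIV. a i * a k * K (x i) (x k))"
proof -
  show mem: "kernel_combination a x \<in> H"
    unfolding kernel_combination_def by (intro sum_mem scale_mem section_mem assms) auto
  show ip: "ip (kernel_combination a x) h = (\<Sum>i\<in>UNIV. a i * h (x i))" if "h \<in> H" for h
    unfolding kernel_combination_def using that assms
    by (subst ip_sum_left)
      (auto simp: ip_scale_left scale_mem section_mem reproducing ip_commute[of "kernel_section S K _"])
  show val: "kernel_combination a x z = (\<Sum>k\<in>UNIV. a k * K z (x k))" if "z \<in> S" for z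
    using that by (simp add: kernel_combination_def kernel_section_def)
  show "ip (kernel_combination a x) (kernel_combination a x) =
      (\<Sum>i\<in>UNIV. \<Sum>k\<in>UNIV. a i * a k * K (x i) (x k))"
    by (simp add: ip[OF mem] val assms sum_distrib_left mult_ac)
qed

lemma gram_matrix_psd:
  fixes a :: "'n::finite \<Rightarrow> real"
  assumes "\<And>i. x i \<in> S"
  shows "(\<Sum>i\<in>UNIV. \<Sum>k\<in>UNIV. a i * a k * K (x i) (x k)) \<ge> 0"
  using ip_nonneg[OF kernel_combination(1)[where x=x and a=a]]
  by (simp add: kernel_combination(4) assms)

end

text \<open>
  The solution of the saddle point system minimizes the penalized loss. Its first order conditions
  cancel the cross terms in the expansion of the loss around it, so the loss of any pair \<open>(\<alpha>, g)\<close> is the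
  minimal loss \<open>\<Sum>i. r i * y i\<close> plus squares. One of them is the squared distance between the vectors of
  fitted values; the other, \<open>c\<close> times the squared norm of the difference of the function parts, is dropped.
\<close>

lemma penalized_least_squares:
  fixes x :: "'n::finite \<Rightarrow> real^'d"
  assumes rkhs: "rkhs S K H ip" and x: "\<And>i. x i \<in> S" and c: "c > 0"
    and det: "det (saddle_matrix c K x) \<noteq> 0"
  obtains \<alpha>\<^sub>0 a g\<^sub>0 where
    "\<And>i. y i - x i \<bullet> \<alpha>\<^sub>0 - (\<Sum>k\<in>UNIV. a k * K (x i) (x k)) = residual c K x y i"
    "(\<Sum>i\<in>UNIV. residual c K x y i * y i) =
      (\<Sum>i\<in>UNIV. (residual c K x y i)\<^sup>2) + c * (\<Sum>i\<in>UNIV. \<Sum>k\<in>UNIV. a i * a k * K (x i) (x k))"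
    "g\<^sub>0 \<in> H"
    "(\<Sum>i\<in>UNIV. (y i - x i \<bullet> \<alpha>\<^sub>0 - g\<^sub>0 (x i))\<^sup>2) + c * ip g\<^sub>0 g\<^sub>0 = (\<Sum>i\<in>UNIV. residual c K x y i * y i)"
    "\<And>\<alpha> g. g \<in> H \<Longrightarrow>
      (\<Sum>i\<in>UNIV. residual c K x y i * y i) + (\<Sum>i\<in>UNIV. (x i \<bullet> \<alpha> + g (x i) - (y i - residual c K x y i))\<^sup>2)
      \<le> (\<Sum>i\<in>UNIV. (y i - x i \<bullet> \<alpha> - g (x i))\<^sup>2) + c * ip g g"
proof -
  interpret rkhs S K H ip by fact
  obtain \<alpha>\<^sub>0 where \<alpha>\<^sub>0:
    "\<And>i. residual c K x y i + (\<Sum>k\<in>UNIV. K (x i) (x k) * residual c K x y k) / c + x i \<bullet> \<alpha>\<^sub>0 = y i"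
    "\<And>j. (\<Sum>i\<in>UNIV. x i $ j * residual c K x y i) = 0"
    using residual_equations[OF det, where y=y] by blast
  define r where "r = residual c K x y"
  define a where "a k = r k / c" for k
  define g\<^sub>0 where "g\<^sub>0 = kernel_combination a x"
  have g\<^sub>0: "g\<^sub>0 \<in> H" "\<And>h. h \<in> H \<Longrightarrow> ip g\<^sub>0 h = (\<Sum>i\<in>UNIV. a i * h (x i))"
      "\<And>i. g\<^sub>0 (x i) = (\<Sum>k\<in>UNIV. a k * K (x i) (x k))"
      "ip g\<^sub>0 g\<^sub>0 = (\<Sum>i\<in>UNIV. \<Sum>k\<in>UNIV. a i * a k * K (x i) (x k))"
    unfolding g\<^sub>0_def by (simp_all add: kernel_combination x sum_distrib_left mult_ac)
  have r: "r i = c * a i" for i using c by (simp add: a_def)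
  have eq: "y i = r i + g\<^sub>0 (x i) + x i \<bullet> \<alpha>\<^sub>0" for i
    using \<alpha>\<^sub>0(1)[of i] by (simp add: g\<^sub>0(3) a_def r_def sum_divide_distrib mult_ac)
  have perp: "(\<Sum>i\<in>UNIV. r i * (x i \<bullet> \<beta>)) = 0" for \<beta>
    using sum_inner_design[OF \<alpha>\<^sub>0(2)] by (simp add: r_def)
  have ry: "(\<Sum>i\<in>UNIV. r i * y i) = (\<Sum>i\<in>UNIV. (r i)\<^sup>2) + c * ip g\<^sub>0 g\<^sub>0"
  proof -
    have "(\<Sum>i\<in>UNIV. r i * y i) = (\<Sum>i\<in>UNIV. (r i)\<^sup>2) + (\<Sum>i\<in>UNIV. r i * g\<^sub>0 (x i)) + (\<Sum>i\<in>UNIV. r i * (x i \<bullet> \<alpha>\<^sub>0))"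
      unfolding sum.distrib[symmetric]
      by (intro sum.cong refl) (simp only: eq, simp add: algebra_simps power2_eq_square)
    also have "(\<Sum>i\<in>UNIV. r i * g\<^sub>0 (x i)) = c * ip g\<^sub>0 g\<^sub>0"
      by (simp add: r g\<^sub>0(2)[OF g\<^sub>0(1)] sum_distrib_left mult_ac)
    finally show ?thesis by (simp add: perp)
  qed
  have identity: "(\<Sum>i\<in>UNIV. (y i - x i \<bullet> \<alpha> - g (x i))\<^sup>2) + c * ip g g
    = (\<Sum>i\<in>UNIV. r i * y i) + (\<Sum>i\<in>UNIV. (x i \<bullet> \<alpha> + g (x i) - (y i - r i))\<^sup>2)
      + c * ip (\<lambda>z. g z - g\<^sub>0 z) (\<lambda>z. g z - g\<^sub>0 z)" if g: "g \<in> H" for \<alpha> g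
  proof -
    let ?h = "\<lambda>z. g z - g\<^sub>0 z"
    have h: "?h \<in> H" using g g\<^sub>0(1) by (rule diff_mem)
    have "ip ?h ?h = ip g ?h - ip g\<^sub>0 ?h" by (rule ip_diff_left[OF g g\<^sub>0(1) h])
    moreover have "ip g ?h = ip g g - ip g\<^sub>0 g"
      using ip_diff_left[OF g g\<^sub>0(1) g] ip_commute[OF g h] by simp
    moreover have "ip g\<^sub>0 ?h = ip g g\<^sub>0 - ip g\<^sub>0 g\<^sub>0"
      using ip_diff_left[OF g g\<^sub>0(1) g\<^sub>0(1)] ip_commute[OF g\<^sub>0(1) h] by simp
    moreover note ip_commute[OF g g\<^sub>0(1)]
    ultimately have ipg: "ip g g = ip g\<^sub>0 g\<^sub>0 + 2 * ip g\<^sub>0 ?h + ip ?h ?h" by simp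
    define d where "d i = x i \<bullet> (\<alpha> - \<alpha>\<^sub>0) + ?h (x i)" for i
    have d: "x i \<bullet> \<alpha> + g (x i) - (y i - r i) = d i" "y i - x i \<bullet> \<alpha> - g (x i) = r i - d i" for i
      by (simp_all add: d_def eq[of i] inner_diff_right)
    have "(\<Sum>i\<in>UNIV. r i * d i) = (\<Sum>i\<in>UNIV. r i * ?h (x i))"
      using perp[of "\<alpha> - \<alpha>\<^sub>0"] by (simp add: d_def distrib_left sum.distrib)
    also have "\<dots> = c * ip g\<^sub>0 ?h"
      by (simp add: g\<^sub>0(2)[OF h] r sum_distrib_left mult_ac)
    finally have rd: "(\<Sum>i\<in>UNIV. r i * d i) = c * ip g\<^sub>0 ?h" .
    have rd2: "(\<Sum>i\<in>UNIV. (r i - d i)\<^sup>2) = (\<Sum>i\<in>UNIV. (r i)\<^sup>2) - 2 * (\<Sum>i\<in>UNIV. r i * d i) + (\<Sum>i\<in>UNIV. (d i)\<^sup>2)"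
      by (simp add: power2_diff sum.distrib sum_subtractf sum_distrib_left mult_ac)
    show ?thesis
      unfolding d ipg ry rd2 rd by (simp add: algebra_simps)
  qed
  show ?thesis
  proof (rule that)
    show "y i - x i \<bullet> \<alpha>\<^sub>0 - (\<Sum>k\<in>UNIV. a k * K (x i) (x k)) = residual c K x y i" for i
      using eq[of i] by (simp add: g\<^sub>0(3) r_def)
    show "(\<Sum>i\<in>UNIV. residual c K x y i * y i) =
      (\<Sum>i\<in>UNIV. (residual c K x y i)\<^sup>2) + c * (\<Sum>i\<in>UNIV. \<Sum>k\<in>UNIV. a i * a k * K (x i) (x k))"
      using ry by (simp add: g\<^sub>0(4) r_def)
    show "g\<^sub>0 \<in> H" by fact
    show "(\<Sum>i\<in>UNIV. (y i - x i \<bullet> \<alpha>\<^sub>0 - g\<^sub>0 (x i))\<^sup>2) + c * ip g\<^sub>0 g\<^sub>0 = (\<Sum>i\<in>UNIV. residual c K x y i * y i)"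
    proof -
      have "y i - x i \<bullet> \<alpha>\<^sub>0 - g\<^sub>0 (x i) = r i" for i
        using eq[of i] by linarith
      then show ?thesis
        using ry by (simp only: r_def)
    qed
    show "(\<Sum>i\<in>UNIV. residual c K x y i * y i) + (\<Sum>i\<in>UNIV. (x i \<bullet> \<alpha> + g (x i) - (y i - residual c K x y i))\<^sup>2)
      \<le> (\<Sum>i\<in>UNIV. (y i - x i \<bullet> \<alpha> - g (x i))\<^sup>2) + c * ip g g" if g: "g \<in> H" for \<alpha> g
      using identity[OF g, of \<alpha>] mult_nonneg_nonneg[OF less_imp_le[OF c] ip_nonneg[OF diff_mem[OF g g\<^sub>0(1)]]]
      by (simp add: r_def)
  qed
qed

lemma fitted_values_unique:
  fixes x :: "'n::finite \<Rightarrow> real^'d"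
  assumes rkhs: "rkhs S K H ip" and x: "\<And>i. x i \<in> S" and l: "l > 0"
    and det: "det (saddle_matrix (real CARD('n) * l) K x) \<noteq> 0"
    and arg_min: "is_arg_min (penalized_loss ip l x y) (\<lambda>(\<alpha>, g). g \<in> H) (\<alpha>, g)"
  shows "x i \<bullet> \<alpha> + g (x i) = y i - residual (real CARD('n) * l) K x y i"
proof -
  interpret rkhs S K H ip by fact
  let ?c = "real CARD('n) * l"
  have c: "?c > 0" using l by simp
  obtain \<alpha>\<^sub>0 a g\<^sub>0 where sol:
    "\<And>i. y i - x i \<bullet> \<alpha>\<^sub>0 - (\<Sum>k\<in>UNIV. a k * K (x i) (x k)) = residual ?c K x y i"
    "(\<Sum>i\<in>UNIV. residual ?c K x y i * y i) =
      (\<Sum>i\<in>UNIV. (residual ?c K x y i)\<^sup>2) + ?c * (\<Sum>i\<in>UNIV. \<Sum>k\<in>UNIV. a i * a k * K (x i) (x k))"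
    "g\<^sub>0 \<in> H"
    "(\<Sum>i\<in>UNIV. (y i - x i \<bullet> \<alpha>\<^sub>0 - g\<^sub>0 (x i))\<^sup>2) + ?c * ip g\<^sub>0 g\<^sub>0 = (\<Sum>i\<in>UNIV. residual ?c K x y i * y i)"
    "\<And>\<alpha> g. g \<in> H \<Longrightarrow>
      (\<Sum>i\<in>UNIV. residual ?c K x y i * y i) + (\<Sum>i\<in>UNIV. (x i \<bullet> \<alpha> + g (x i) - (y i - residual ?c K x y i))\<^sup>2)
      \<le> (\<Sum>i\<in>UNIV. (y i - x i \<bullet> \<alpha> - g (x i))\<^sup>2) + ?c * ip g g"
    using penalized_least_squares[OF rkhs x c det, where y="y"] by blast
  have g: "g \<in> H" using arg_min by (simp add: is_arg_min_def)
  have loss: "real CARD('n) * penalized_loss ip l x y (\<beta>, h) =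
      (\<Sum>i\<in>UNIV. (y i - x i \<bullet> \<beta> - h (x i))\<^sup>2) + ?c * ip h h" if "h \<in> H" for \<beta> h
    using that by (simp add: penalized_loss_def hilbert_norm_square algebra_simps)
  have "penalized_loss ip l x y (\<alpha>, g) \<le> penalized_loss ip l x y (\<alpha>\<^sub>0, g\<^sub>0)"
    using arg_min sol(3) by (auto simp: is_arg_min_def not_less)
  then have "real CARD('n) * penalized_loss ip l x y (\<alpha>, g) \<le> real CARD('n) * penalized_loss ip l x y (\<alpha>\<^sub>0, g\<^sub>0)"
    by (simp add: mult_left_mono)
  then have "(\<Sum>i\<in>UNIV. (x i \<bullet> \<alpha> + g (x i) - (y i - residual ?c K x y i))\<^sup>2) \<le> 0"
    using sol(4) sol(5)[OF g, of \<alpha>] by (simp add: loss g sol(3))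
  then have "(\<Sum>i\<in>UNIV. (x i \<bullet> \<alpha> + g (x i) - (y i - residual ?c K x y i))\<^sup>2) = 0"
    by (simp add: antisym sum_nonneg)
  then have "\<forall>i\<in>UNIV. (x i \<bullet> \<alpha> + g (x i) - (y i - residual ?c K x y i))\<^sup>2 = 0"
    by (subst (asm) sum_nonneg_eq_0_iff) auto
  then show ?thesis by simp
qed

text \<open>
  The minimal loss contains the squared residuals, so these are below the loss of every competitor.
\<close>

lemma residual_norm_le_loss:
  fixes x :: "'n::finite \<Rightarrow> real^'d"
  assumes rkhs: "rkhs S K H ip" and x: "\<And>i. x i \<in> S" and c: "c > 0"
    and det: "det (saddle_matrix c K x) \<noteq> 0" and g: "g \<in> H"
  shows "(\<Sum>i\<in>UNIV. (residual c K x y i)\<^sup>2) \<le> (\<Sum>i\<in>UNIV. (y i - x i \<bullet> \<alpha> - g (x i))\<^sup>2) + c * ip g g"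
proof -
  interpret rkhs S K H ip by fact
  obtain \<alpha>\<^sub>0 a g\<^sub>0 where sol:
    "\<And>i. y i - x i \<bullet> \<alpha>\<^sub>0 - (\<Sum>k\<in>UNIV. a k * K (x i) (x k)) = residual c K x y i"
    "(\<Sum>i\<in>UNIV. residual c K x y i * y i) =
      (\<Sum>i\<in>UNIV. (residual c K x y i)\<^sup>2) + c * (\<Sum>i\<in>UNIV. \<Sum>k\<in>UNIV. a i * a k * K (x i) (x k))"
    "g\<^sub>0 \<in> H"
    "(\<Sum>i\<in>UNIV. (y i - x i \<bullet> \<alpha>\<^sub>0 - g\<^sub>0 (x i))\<^sup>2) + c * ip g\<^sub>0 g\<^sub>0 = (\<Sum>i\<in>UNIV. residual c K x y i * y i)"
    "\<And>\<alpha> g. g \<in> H \<Longrightarrow>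
      (\<Sum>i\<in>UNIV. residual c K x y i * y i) + (\<Sum>i\<in>UNIV. (x i \<bullet> \<alpha> + g (x i) - (y i - residual c K x y i))\<^sup>2)
      \<le> (\<Sum>i\<in>UNIV. (y i - x i \<bullet> \<alpha> - g (x i))\<^sup>2) + c * ip g g"
    using penalized_least_squares[OF rkhs x c det, where y="y"] by blast
  have "(\<Sum>i\<in>UNIV. (x i \<bullet> \<alpha> + g (x i) - (y i - residual c K x y i))\<^sup>2) \<ge> 0"
    by (simp add: sum_nonneg)
  moreover have "c * (\<Sum>i\<in>UNIV. \<Sum>k\<in>UNIV. a i * a k * K (x i) (x k)) \<ge> 0"
    using gram_matrix_psd[where x=x, OF x] c by simp
  ultimately show ?thesis
    using sol(2) sol(5)[OF g, of \<alpha>] by linarith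
qed

text \<open>
  The entry \<open>B k k\<close> is the minimal loss for the data \<open>axis k 1\<close>, namely \<open>\<bar>B e\<bar>\<^sup>2\<close> plus a nonnegative penalty for
  \<open>e = axis k 1\<close>. Hence \<open>\<bar>e - B e\<bar>\<^sup>2 = 1 - 2 * B k k + \<bar>B e\<bar>\<^sup>2 \<le> 1 - B k k\<close>, which is the comparison of the Frobenius norm
  of the smoother with its trace, column by column.
\<close>

lemma residual_matrix_diagonal:
  fixes x :: "'n::finite \<Rightarrow> real^'d"
  assumes rkhs: "rkhs S K H ip" and x: "\<And>i. x i \<in> S" and c: "c > 0"
    and det: "det (saddle_matrix c K x) \<noteq> 0"
  obtains \<alpha> a where "residual_matrix c K x k k =
     (\<Sum>i\<in>UNIV. (axis k 1 $ i - x i \<bullet> \<alpha> - (\<Sum>l\<in>UNIV. a l * K (x i) (x l)))\<^sup>2)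
      + c * (\<Sum>l\<in>UNIV. \<Sum>m\<in>UNIV. a l * a m * K (x l) (x m))"
    "(\<Sum>i\<in>UNIV. (axis k 1 $ i - residual_matrix c K x i k)\<^sup>2) \<le> 1 - residual_matrix c K x k k"
    "0 \<le> residual_matrix c K x k k"
proof -
  interpret rkhs S K H ip by fact
  let ?e = "\<lambda>i. if i = k then 1 else 0 :: real"
  obtain \<alpha>\<^sub>0 a g\<^sub>0 where sol:
    "\<And>i. ?e i - x i \<bullet> \<alpha>\<^sub>0 - (\<Sum>k\<in>UNIV. a k * K (x i) (x k)) = residual c K x ?e i"
    "(\<Sum>i\<in>UNIV. residual c K x ?e i * ?e i) =
      (\<Sum>i\<in>UNIV. (residual c K x ?e i)\<^sup>2) + c * (\<Sum>i\<in>UNIV. \<Sum>k\<in>UNIV. a i * a k * K (x i) (x k))"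
    "g\<^sub>0 \<in> H"
    "(\<Sum>i\<in>UNIV. (?e i - x i \<bullet> \<alpha>\<^sub>0 - g\<^sub>0 (x i))\<^sup>2) + c * ip g\<^sub>0 g\<^sub>0 = (\<Sum>i\<in>UNIV. residual c K x ?e i * ?e i)"
    "\<And>\<alpha> g. g \<in> H \<Longrightarrow>
      (\<Sum>i\<in>UNIV. residual c K x ?e i * ?e i) + (\<Sum>i\<in>UNIV. (x i \<bullet> \<alpha> + g (x i) - (?e i - residual c K x ?e i))\<^sup>2)
      \<le> (\<Sum>i\<in>UNIV. (?e i - x i \<bullet> \<alpha> - g (x i))\<^sup>2) + c * ip g g"
    using penalized_least_squares[OF rkhs x c det, where y="?e"] by blast
  note a = sol(1,2)[unfolded residual_indicator]
  have diag: "(\<Sum>i\<in>UNIV. residual_matrix c K x i k * ?e i) = residual_matrix c K x k k"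
    by (simp add: if_distrib cong: if_cong)
  have pos: "c * (\<Sum>i\<in>UNIV. \<Sum>l\<in>UNIV. a i * a l * K (x i) (x l)) \<ge> 0"
    using gram_matrix_psd[where x=x, OF x] c by simp
  have e: "axis k 1 $ i = ?e i" for i by (simp add: axis_def)
  show ?thesis
  proof (rule that)
    show "residual_matrix c K x k k =
     (\<Sum>i\<in>UNIV. (axis k 1 $ i - x i \<bullet> \<alpha>\<^sub>0 - (\<Sum>l\<in>UNIV. a l * K (x i) (x l)))\<^sup>2)
      + c * (\<Sum>l\<in>UNIV. \<Sum>m\<in>UNIV. a l * a m * K (x l) (x m))"
    proof -
      have "axis k 1 $ i - x i \<bullet> \<alpha>\<^sub>0 - (\<Sum>l\<in>UNIV. a l * K (x i) (x l)) = residual_matrix c K x i k" for i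
        using a(1)[of i] by (simp only: e)
      then show ?thesis using a(2) by (simp only: diag)
    qed
    have "(\<Sum>i\<in>UNIV. (?e i - residual_matrix c K x i k)\<^sup>2) =
       (\<Sum>i\<in>UNIV. ?e i * ?e i) - 2 * (\<Sum>i\<in>UNIV. residual_matrix c K x i k * ?e i) + (\<Sum>i\<in>UNIV. (residual_matrix c K x i k)\<^sup>2)"
      by (simp only: power2_diff sum.distrib sum_subtractf sum_distrib_left)
        (simp add: power2_eq_square mult_ac)
    also have "(\<Sum>i\<in>UNIV. ?e i * ?e i) = 1"
      by (simp add: if_distrib cong: if_cong)
    finally show "(\<Sum>i\<in>UNIV. (axis k 1 $ i - residual_matrix c K x i k)\<^sup>2) \<le> 1 - residual_matrix c K x k k"
      using a(2) pos unfolding e diag by linarith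
    have "(\<Sum>i\<in>UNIV. (residual_matrix c K x i k)\<^sup>2) \<ge> 0" by (simp add: sum_nonneg)
    then show "0 \<le> residual_matrix c K x k k"
      using a(2) pos unfolding diag by linarith
  qed
qed

section \<open>The trace of the smoother and low-rank approximations of the kernel\<close>

text \<open>
  For the Gram matrix \<open>G\<close> of finitely many features, the first \<open>N\<close> features are treated like additional
  columns of the design, without penalty; the others are charged with their squared length.
\<close>

lemma effective_dimension_finite_rank:
  fixes x :: "'n::finite \<Rightarrow> real^'d" and p :: "nat \<Rightarrow> 'n \<Rightarrow> real"
    and \<alpha> :: "'n \<Rightarrow> real^'d" and a :: "'n \<Rightarrow> 'n \<Rightarrow> real"
  assumes \<mu>: "\<And>j. \<mu> j \<ge> 0" and c: "c > 0" and N: "N \<le> L"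
    and G: "\<And>i l. G i l = (\<Sum>j<L. \<mu> j * p j i * p j l)"
  shows "real CARD('n) \<le> real (CARD('d) + N) + (\<Sum>j\<in>{N..<L}. \<mu> j * (\<Sum>i\<in>UNIV. (p j i)\<^sup>2)) / c
    + (\<Sum>k\<in>UNIV. (\<Sum>i\<in>UNIV. (axis k 1 $ i - x i \<bullet> \<alpha> k - (\<Sum>l\<in>UNIV. a k l * G i l))\<^sup>2)
        + c * (\<Sum>l\<in>UNIV. \<Sum>m\<in>UNIV. a k l * a k m * G l m))"
proof -
  \<comment> \<open>With these vectors \<open>G\<close> is the sum of the matrices \<open>u j * (u j)^T\<close>.\<close>
  define u :: "nat \<Rightarrow> real^'n" where "u j = (\<chi> i. sqrt (\<mu> j) * p j i)" for j
  define col :: "'d \<Rightarrow> real^'n" where "col q = (\<chi> i. x i $ q)" for q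
  define T where "T = range col \<union> u ` {..<N}"
  define t where "t k j = (\<Sum>l\<in>UNIV. a k l * u j $ l)" for k j
  define v where "v k = (\<Sum>q\<in>UNIV. \<alpha> k $ q *\<^sub>R col q) + (\<Sum>j<N. t k j *\<^sub>R u j)" for k
  have "card T \<le> card (range col) + card (u ` {..<N})"
    unfolding T_def by (rule card_Un_le)
  also have "\<dots> \<le> CARD('d) + N"
    using card_image_le[of UNIV col] card_image_le[of "{..<N}" u] by simp
  finally have card: "real (card T) \<le> real (CARD('d) + N)" by linarith
  have span: "v k \<in> span T" for k
    unfolding v_def T_def by (intro span_add span_sum span_scale span_base) auto
  have uu: "u j $ i * u j $ l = \<mu> j * p j i * p j l" for i j l
  proof -
    have "u j $ i * u j $ l = (sqrt (\<mu> j) * sqrt (\<mu> j)) * p j i * p j l"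
      by (simp add: u_def)
    then show ?thesis by (simp add: \<mu>)
  qed
  have Gu: "G i l = (\<Sum>j<L. u j $ i * u j $ l)" for i l
    by (simp add: G uu)
  have fit: "(\<Sum>l\<in>UNIV. a k l * G i l) = (\<Sum>j<L. t k j * u j $ i)" for k i
  proof -
    have "(\<Sum>l\<in>UNIV. a k l * G i l) = (\<Sum>l\<in>UNIV. \<Sum>j<L. a k l * (u j $ i * u j $ l))"
      by (simp add: Gu sum_distrib_left)
    also have "\<dots> = (\<Sum>j<L. \<Sum>l\<in>UNIV. a k l * (u j $ i * u j $ l))"
      by (rule sum.swap)
    finally show ?thesis
      by (simp add: t_def sum_distrib_right sum_distrib_left mult_ac)
  qed
  have split: "(\<Sum>j<L. f j) = (\<Sum>j<N. f j) + (\<Sum>j\<in>{N..<L}. f j)" for f :: "nat \<Rightarrow> real"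
    using sum.atLeastLessThan_concat[of 0 N L f] N by (simp add: lessThan_atLeast0)
  have res: "(norm (axis k 1 - v k - (\<Sum>j\<in>{N..<L}. t k j *\<^sub>R u j)))\<^sup>2 =
      (\<Sum>i\<in>UNIV. (axis k 1 $ i - x i \<bullet> \<alpha> k - (\<Sum>l\<in>UNIV. a k l * G i l))\<^sup>2)" for k
  proof -
    have "(axis k 1 - v k - (\<Sum>j\<in>{N..<L}. t k j *\<^sub>R u j)) $ i =
      axis k 1 $ i - x i \<bullet> \<alpha> k - (\<Sum>l\<in>UNIV. a k l * G i l)" for i
      unfolding fit split
      by (simp add: v_def col_def inner_vec_def mult.commute)
    then show ?thesis
      by (simp only: power2_norm_eq_inner, simp only: inner_vec_def inner_real_def power2_eq_square)
  qed
  have quad: "(\<Sum>j\<in>{N..<L}. (t k j)\<^sup>2) \<le> (\<Sum>l\<in>UNIV. \<Sum>m\<in>UNIV. a k l * a k m * G l m)" for k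
  proof -
    have "(\<Sum>l\<in>UNIV. \<Sum>m\<in>UNIV. a k l * a k m * G l m) = (\<Sum>l\<in>UNIV. a k l * (\<Sum>m\<in>UNIV. a k m * G l m))"
      by (simp add: sum_distrib_left mult_ac)
    also have "\<dots> = (\<Sum>l\<in>UNIV. \<Sum>j<L. a k l * (t k j * u j $ l))"
      by (simp add: fit sum_distrib_left)
    also have "\<dots> = (\<Sum>j<L. \<Sum>l\<in>UNIV. a k l * (t k j * u j $ l))"
      by (rule sum.swap)
    also have "\<dots> = (\<Sum>j<L. (t k j)\<^sup>2)"
      by (simp add: t_def power2_eq_square sum_distrib_left mult_ac)
    also have "\<dots> \<ge> (\<Sum>j\<in>{N..<L}. (t k j)\<^sup>2)"
      by (intro sum_mono2) auto
    finally show ?thesis .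
  qed
  have nu: "(norm (u j))\<^sup>2 = \<mu> j * (\<Sum>i\<in>UNIV. (p j i)\<^sup>2)" for j
    by (simp only: power2_norm_eq_inner, simp only: inner_vec_def inner_real_def uu)
      (simp add: sum_distrib_left power2_eq_square mult_ac)
  have "real CARD('n) \<le> real (card T) + (\<Sum>j\<in>{N..<L}. (norm (u j))\<^sup>2) / c
    + (\<Sum>k\<in>UNIV. (norm (axis k 1 - v k - (\<Sum>j\<in>{N..<L}. t k j *\<^sub>R u j)))\<^sup>2 + c * (\<Sum>j\<in>{N..<L}. (t k j)\<^sup>2))"
    by (rule trace_residual_lower_bound[OF _ span c]) (simp add: T_def)
  also have "\<dots> \<le> real (CARD('d) + N) + (\<Sum>j\<in>{N..<L}. \<mu> j * (\<Sum>i\<in>UNIV. (p j i)\<^sup>2)) / c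
    + (\<Sum>k\<in>UNIV. (\<Sum>i\<in>UNIV. (axis k 1 $ i - x i \<bullet> \<alpha> k - (\<Sum>l\<in>UNIV. a k l * G i l))\<^sup>2)
        + c * (\<Sum>l\<in>UNIV. \<Sum>m\<in>UNIV. a k l * a k m * G l m))"
    unfolding nu res using c
    by (intro add_mono card order_refl sum_mono mult_left_mono quad) simp
  finally show ?thesis .
qed

lemma ennreal_add_le: "ennreal (a + b) \<le> ennreal a + ennreal b"
proof -
  have "ennreal (a + b) \<le> ennreal (max 0 a + max 0 b)"
    by (intro ennreal_leI) simp
  also have "\<dots> = ennreal a + ennreal b"
    by (subst ennreal_plus) (auto simp: max_def ennreal_neg)
  finally show ?thesis .
qed

text \<open>
  For fixed coefficients \<open>\<alpha>\<close> and \<open>a\<close> the losses depend continuously on the Gram matrix, so the bound passes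
  to limits of Gram matrices even though the minimizing coefficients may change along the sequence.
  Two limits are taken: the number of features tends to infinity, then the resolution \<open>r\<close> does.
\<close>

lemma effective_dimension_limit:
  fixes x :: "'n::finite \<Rightarrow> real^'d" and p :: "nat \<Rightarrow> nat \<Rightarrow> 'n \<Rightarrow> real"
    and \<alpha> :: "'n \<Rightarrow> real^'d" and a :: "'n \<Rightarrow> 'n \<Rightarrow> real"
  assumes \<mu>: "\<And>j. \<mu> j \<ge> 0" and c: "c > 0"
    and series: "\<And>r i l. (\<lambda>L. \<Sum>j<L. \<mu> j * p r j i * p r j l) \<longlonglongrightarrow> Gr r i l"
    and limit: "\<And>i l. (\<lambda>r. Gr r i l) \<longlonglongrightarrow> G i l"
  shows "ennreal (real CARD('n)) \<le> ennreal (real (CARD('d) + N))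
    + liminf (\<lambda>r. ennreal (1 / c) * (\<Sum>j. ennreal (\<mu> (j + N) * (\<Sum>i\<in>UNIV. (p r (j + N) i)\<^sup>2))))
    + ennreal (\<Sum>k\<in>UNIV. (\<Sum>i\<in>UNIV. (axis k 1 $ i - x i \<bullet> \<alpha> k - (\<Sum>l\<in>UNIV. a k l * G i l))\<^sup>2)
        + c * (\<Sum>l\<in>UNIV. \<Sum>m\<in>UNIV. a k l * a k m * G l m))"
proof -
  define Q where "Q G = (\<Sum>k\<in>UNIV. (\<Sum>i\<in>UNIV. (axis k 1 $ i - x i \<bullet> \<alpha> k - (\<Sum>l\<in>UNIV. a k l * G i l))\<^sup>2)
        + c * (\<Sum>l\<in>UNIV. \<Sum>m\<in>UNIV. a k l * a k m * G l m))" for G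
  define C where "C r = ennreal (1 / c) * (\<Sum>j. ennreal (\<mu> (j + N) * (\<Sum>i\<in>UNIV. (p r (j + N) i)\<^sup>2)))" for r
  let ?D = "ennreal (real (CARD('d) + N))"
  have QlimI: "((\<lambda>L. Q (F L)) \<longlonglongrightarrow> Q F')" if "\<And>i l. (\<lambda>L. F L i l) \<longlonglongrightarrow> F' i l" for F F'
    unfolding Q_def by (intro tendsto_intros that)
  have 1: "ennreal (real CARD('n)) \<le> ?D + C r + ennreal (Q (Gr r))" for r
  proof (rule LIMSEQ_le_const)
    let ?F = "\<lambda>L i l. \<Sum>j<L. \<mu> j * p r j i * p r j l"
    show "(\<lambda>L. ?D + C r + ennreal (Q (?F L))) \<longlonglongrightarrow> ?D + C r + ennreal (Q (Gr r))"
      by (intro tendsto_add tendsto_const tendsto_ennrealI QlimI series)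
    show "\<exists>L0. \<forall>L\<ge>L0. ennreal (real CARD('n)) \<le> ?D + C r + ennreal (Q (?F L))"
    proof (intro exI allI impI)
      fix L assume L: "N \<le> L"
      let ?f = "\<lambda>j. \<mu> j * (\<Sum>i\<in>UNIV. (p r j i)\<^sup>2)"
      have f0: "?f j \<ge> 0" for j by (simp add: \<mu> sum_nonneg)
      have "sum ?f {N..<L} = (\<Sum>j<L - N. ?f (j + N))"
        using L sum.shift_bounds_nat_ivl[of ?f 0 N "L - N"] by (simp add: lessThan_atLeast0)
      then have "ennreal (sum ?f {N..<L} / c) = ennreal (1 / c) * (\<Sum>j<L - N. ennreal (?f (j + N)))"
        using c by (simp add: f0 sum_nonneg flip: ennreal_mult)
      also have "\<dots> \<le> C r"
        unfolding C_def by (intro mult_left_mono sum_le_suminf) (auto simp: summableI)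
      finally have tail: "ennreal (sum ?f {N..<L} / c) \<le> C r" .
      have "ennreal (real CARD('n)) \<le> ennreal (real (CARD('d) + N) + sum ?f {N..<L} / c + Q (?F L))"
        unfolding Q_def
        by (intro ennreal_leI effective_dimension_finite_rank[OF \<mu> c L]) simp
      also have "\<dots> \<le> ennreal (real (CARD('d) + N) + sum ?f {N..<L} / c) + ennreal (Q (?F L))"
        by (rule ennreal_add_le)
      also have "\<dots> \<le> ?D + ennreal (sum ?f {N..<L} / c) + ennreal (Q (?F L))"
        using c by (intro add_right_mono) (simp add: f0 sum_nonneg)
      also have "\<dots> \<le> ?D + C r + ennreal (Q (?F L))"
        by (intro add_mono tail) auto
      finally show "ennreal (real CARD('n)) \<le> ?D + C r + ennreal (Q (?F L))" .
    qed
  qed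
  have "ennreal (real CARD('n)) \<le> ?D + liminf C + ennreal (Q G)"
  \<comment> \<open>The tail term has a lower limit only, so the convergent term is first replaced by its limit up to \<open>e\<close>.\<close>
  proof (rule ennreal_le_epsilon)
    fix e :: real assume e: "e > 0"
    have "eventually (\<lambda>r. Q (Gr r) < Q G + e) sequentially"
      using QlimI[OF limit] e by (intro order_tendstoD(2)[where y="Q G"]) auto
    then have "eventually (\<lambda>r. ennreal (real CARD('n)) - (?D + ennreal (Q G + e)) \<le> C r) sequentially"
    proof eventually_elim
      case (elim r)
      have "ennreal (real CARD('n)) \<le> ?D + C r + ennreal (Q (Gr r))" by (rule 1)
      also have "\<dots> \<le> ?D + C r + ennreal (Q G + e)"
        using elim by (intro add_left_mono ennreal_leI) simp
      finally show ?case
        by (subst ennreal_minus_le_iff) (auto simp: add_ac)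
    qed
    then have "ennreal (real CARD('n)) - (?D + ennreal (Q G + e)) \<le> liminf C"
      by (rule Liminf_bounded)
    then have "ennreal (real CARD('n)) \<le> ?D + ennreal (Q G + e) + liminf C"
      by (subst (asm) ennreal_minus_le_iff) auto
    also have "\<dots> \<le> ?D + (ennreal (Q G) + ennreal e) + liminf C"
      by (intro add_mono ennreal_add_le) auto
    finally show "ennreal (real CARD('n)) \<le> ?D + liminf C + ennreal (Q G) + ennreal e"
      by (simp add: add_ac)
  qed
  then show ?thesis
    unfolding Q_def C_def .
qed

section \<open>Averages over dyadic cells\<close>

lemma L2_functions_mult_integrable:
  assumes "f \<in> L2_functions \<rho>" "g \<in> L2_functions \<rho>"
  shows "integrable \<rho> (\<lambda>x. f x * g x)"
proof (rule Bochner_Integration.integrable_bound)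
  show "integrable \<rho> (\<lambda>x. (f x)\<^sup>2 + (g x)\<^sup>2)"
    using assms by (auto simp: L2_functions_def)
  show "(\<lambda>x. f x * g x) \<in> borel_measurable \<rho>"
    using assms by (auto simp: L2_functions_def)
  have "\<bar>a * b\<bar> \<le> a\<^sup>2 + b\<^sup>2" for a b :: real
  proof -
    have "0 \<le> (\<bar>a\<bar> - \<bar>b\<bar>)\<^sup>2" by simp
    then have "2 * (\<bar>a\<bar> * \<bar>b\<bar>) \<le> a\<^sup>2 + b\<^sup>2" by (simp add: power2_diff)
    moreover have "0 \<le> \<bar>a\<bar> * \<bar>b\<bar>" by simp
    ultimately show ?thesis unfolding abs_mult by linarith
  qed
  then show "AE x in \<rho>. norm (f x * g x) \<le> norm ((f x)\<^sup>2 + (g x)\<^sup>2)"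
    by simp
qed

lemma L2_functions_diff:
  assumes "f \<in> L2_functions \<rho>" "g \<in> L2_functions \<rho>"
  shows "(\<lambda>x. f x - g x) \<in> L2_functions \<rho>"
  using assms L2_functions_mult_integrable[OF assms]
  by (auto simp: L2_functions_def power2_diff mult.assoc)

lemma L2_functions_add:
  assumes "f \<in> L2_functions \<rho>" "g \<in> L2_functions \<rho>"
  shows "(\<lambda>x. f x + g x) \<in> L2_functions \<rho>"
  using assms L2_functions_mult_integrable[OF assms]
  by (auto simp: L2_functions_def power2_sum mult.assoc)

lemma L2_functions_scale: "f \<in> L2_functions \<rho> \<Longrightarrow> (\<lambda>x. c * f x) \<in> L2_functions \<rho>"
  by (auto simp: L2_functions_def power_mult_distrib)

lemma L2_functions_sum:
  "finite I \<Longrightarrow> (\<And>i. i \<in> I \<Longrightarrow> f i \<in> L2_functions \<rho>) \<Longrightarrow> (\<lambda>x. \<Sum>i\<in>I. f i x) \<in> L2_functions \<rho>"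
proof (induction I rule: finite_induct)
  case empty
  then show ?case by (simp add: L2_functions_def)
next
  case (insert i I)
  then have "(\<lambda>x. f i x + (\<Sum>i\<in>I. f i x)) \<in> L2_functions \<rho>"
    by (intro L2_functions_add) auto
  with insert show ?case by simp
qed

text \<open>
  Convergence in \<open>L\<^sub>2\<close> implies convergence of the inner products with a bounded function, because
  \<open>\<bar>\<integral>h v\<bar>\<close> is at most the \<open>L\<^sub>2\<close> norm of \<open>v\<close> if \<open>\<bar>h\<bar> \<le> 1\<close> on a probability space.
\<close>

lemma (in prob_space) L2_sums_inner:
  assumes sums: "L2_sums M u f" and h: "h \<in> borel_measurable M" "\<And>x. \<bar>h x\<bar> \<le> 1"
    and f: "f \<in> L2_functions M" and u: "\<And>j. u j \<in> L2_functions M"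
  shows "(\<lambda>L. \<Sum>j<L. L2_inner M h (u j)) \<longlonglongrightarrow> L2_inner M h f"
proof -
  have h1: "(h x)\<^sup>2 \<le> 1" for x
    using h(2)[of x] by (simp add: abs_square_le_1)
  have hL2: "h \<in> L2_functions M"
    using h by (auto simp: L2_functions_def h1 intro!: integrable_const_bound[where B=1])
  have le: "\<bar>L2_inner M h v\<bar> \<le> L2_norm M v" if v: "v \<in> L2_functions M" for v
  proof -
    have int: "integrable M (\<lambda>x. h x * v x)"
      by (rule L2_functions_mult_integrable[OF hL2 v])
    have v2: "integrable M (\<lambda>x. (v x)\<^sup>2)" and [measurable]: "v \<in> borel_measurable M"
      using v by (auto simp: L2_functions_def)
    note [measurable] = h(1)
    have le2: "(h x * v x)\<^sup>2 \<le> (v x)\<^sup>2" for x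
      using mult_right_mono[OF h1[of x], of "(v x)\<^sup>2"] by (simp add: power_mult_distrib)
    have int2: "integrable M (\<lambda>x. (h x * v x)\<^sup>2)"
      by (rule Bochner_Integration.integrable_bound[OF v2]) (auto simp: le2)
    have "(L2_inner M h v)\<^sup>2 \<le> (\<integral>x. (h x * v x)\<^sup>2 \<partial>M)"
      using variance_eq[OF int int2] variance_positive[of "\<lambda>x. h x * v x"] by (simp add: L2_inner_def)
    also have "\<dots> \<le> (\<integral>x. (v x)\<^sup>2 \<partial>M)"
      by (intro integral_mono int2 v2 le2)
    finally have "sqrt ((L2_inner M h v)\<^sup>2) \<le> sqrt (\<integral>x. (v x)\<^sup>2 \<partial>M)"
      by (rule real_sqrt_le_mono)
    then show ?thesis by (simp add: L2_norm_def L2_inner_def power2_eq_square)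
  qed
  have diff: "L2_inner M h f - (\<Sum>j<L. L2_inner M h (u j)) = L2_inner M h (\<lambda>x. f x - (\<Sum>j<L. u j x))" for L
    unfolding L2_inner_def
    by (simp add: right_diff_distrib sum_distrib_left L2_functions_mult_integrable hL2 f u)
  have "(\<lambda>L. L2_inner M h f - (\<Sum>j<L. L2_inner M h (u j))) \<longlonglongrightarrow> 0"
  proof (rule Lim_null_comparison)
    show "(\<lambda>L. L2_norm M (\<lambda>x. f x - (\<Sum>j<L. u j x))) \<longlonglongrightarrow> 0"
      using sums by (simp add: L2_sums_def)
    show "\<forall>\<^sub>F L in sequentially. norm (L2_inner M h f - (\<Sum>j<L. L2_inner M h (u j)))
        \<le> L2_norm M (\<lambda>x. f x - (\<Sum>j<L. u j x))"
      unfolding diff by (auto intro!: always_eventually le L2_functions_diff L2_functions_sum f u)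
  qed
  from tendsto_diff[OF tendsto_const[of "L2_inner M h f"] this] show ?thesis by simp
qed

definition grid_index :: "nat \<Rightarrow> real^'d \<Rightarrow> int^'d" where
  "grid_index r x = (\<chi> i. \<lfloor>2 ^ r * x $ i\<rfloor>)"

definition grid_cell :: "nat \<Rightarrow> real^'d \<Rightarrow> (real^'d) set" where
  "grid_cell r x = {y. grid_index r y = grid_index r x}"

lemma grid_cell_iff:
  "y \<in> grid_cell r x \<longleftrightarrow> (\<forall>i. real_of_int \<lfloor>2 ^ r * y $ i\<rfloor> \<le> real_of_int \<lfloor>2 ^ r * x $ i\<rfloor> \<and>
     real_of_int \<lfloor>2 ^ r * x $ i\<rfloor> \<le> real_of_int \<lfloor>2 ^ r * y $ i\<rfloor>)"
  by (simp add: grid_cell_def grid_index_def vec_eq_iff eq_iff)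

lemma grid_cell_self: "x \<in> grid_cell r x"
  by (simp add: grid_cell_def)

lemma grid_cell_commute: "y \<in> grid_cell r x \<longleftrightarrow> x \<in> grid_cell r y"
  by (auto simp: grid_cell_def)

lemma grid_cell_eq: "y \<in> grid_cell r x \<Longrightarrow> grid_cell r y = grid_cell r x"
  by (simp add: grid_cell_def)

lemma dist_grid_cell:
  fixes x y :: "real^'d"
  assumes "y \<in> grid_cell r x"
  shows "dist y x \<le> real CARD('d) / 2 ^ r"
proof -
  have "\<bar>y $ i - x $ i\<bar> \<le> 1 / 2 ^ r" for i
  proof -
    have "\<lfloor>2 ^ r * y $ i\<rfloor> = \<lfloor>2 ^ r * x $ i\<rfloor>"
      using assms by (simp add: grid_cell_def grid_index_def vec_eq_iff)
    then have "\<bar>2 ^ r * y $ i - 2 ^ r * x $ i\<bar> \<le> 1" by linarith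
    also have "\<bar>2 ^ r * y $ i - 2 ^ r * x $ i\<bar> = 2 ^ r * \<bar>y $ i - x $ i\<bar>"
      by (simp add: abs_mult flip: right_diff_distrib)
    finally show ?thesis by (simp add: field_simps)
  qed
  then have "(\<Sum>i\<in>UNIV. \<bar>(y - x) $ i\<bar>) \<le> (\<Sum>i\<in>(UNIV::'d set). 1 / 2 ^ r)"
    by (intro sum_mono) simp
  then show ?thesis
    using norm_le_l1_cart[of "y - x"] by (simp add: dist_norm)
qed

text \<open>
  The set \<open>S\<close> need not be a Borel set, so the measure lives on the trace of the Borel sets on \<open>S\<close>.
\<close>

locale prob_space_on = prob_space \<rho> for \<rho> :: "(real^'d) measure" +
  fixes S :: "(real^'d) set"
  assumes sets_eq: "sets \<rho> = sets (restrict_space borel S)"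
begin

lemma space_eq: "space \<rho> = S"
  using sets_eq_imp_space_eq[OF sets_eq] by (simp add: space_restrict_space)

lemma measurable_component [measurable]: "(\<lambda>x. x $ i) \<in> borel_measurable \<rho>"
proof -
  have "(\<lambda>x::real^'d. x $ i) \<in> borel_measurable (restrict_space borel S)"
    by (intro measurable_restrict_space1) measurable
  then show ?thesis
    using measurable_cong_sets[OF sets_eq refl] by blast
qed

lemma grid_cell_measurable_pair [measurable]:
  "Measurable.pred (\<rho> \<Otimes>\<^sub>M \<rho>) (\<lambda>p. snd p \<in> grid_cell r (fst p))"
proof -
  have coord: "(\<lambda>x. real_of_int \<lfloor>2 ^ r * x $ i\<rfloor>) \<in> borel_measurable \<rho>" for i
    by measurable
  have "Measurable.pred (\<rho> \<Otimes>\<^sub>M \<rho>) (\<lambda>p. real_of_int \<lfloor>2 ^ r * fst p $ i\<rfloor> \<le> real_of_int \<lfloor>2 ^ r * snd p $ i\<rfloor>)"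
      "Measurable.pred (\<rho> \<Otimes>\<^sub>M \<rho>) (\<lambda>p. real_of_int \<lfloor>2 ^ r * snd p $ i\<rfloor> \<le> real_of_int \<lfloor>2 ^ r * fst p $ i\<rfloor>)" for i
    using borel_measurable_le[OF measurable_compose[OF measurable_fst coord] measurable_compose[OF measurable_snd coord]]
      borel_measurable_le[OF measurable_compose[OF measurable_snd coord] measurable_compose[OF measurable_fst coord]]
    by (auto simp: pred_def)
  then show ?thesis
    unfolding grid_cell_iff by (intro pred_intros_countable pred_intros_logic)
qed

lemma grid_cell_pred [measurable]: "Measurable.pred \<rho> (\<lambda>y. y \<in> grid_cell r x)"
  unfolding grid_cell_iff by measurable

lemma grid_index_pred [measurable]: "Measurable.pred \<rho> (\<lambda>y. grid_index r y = c)"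
proof -
  have "(grid_index r y = c) \<longleftrightarrow> (\<forall>i. real_of_int \<lfloor>2 ^ r * y $ i\<rfloor> \<le> real_of_int (c $ i) \<and>
      real_of_int (c $ i) \<le> real_of_int \<lfloor>2 ^ r * y $ i\<rfloor>)" for y
    by (simp add: grid_index_def vec_eq_iff eq_iff)
  then show ?thesis by simp
qed

definition cell_mass :: "nat \<Rightarrow> real^'d \<Rightarrow> real" where
  "cell_mass r x = (\<integral>y. indicator (grid_cell r x) y \<partial>\<rho>)"

text \<open>
  On a cell of mass \<open>0\<close> the average is \<open>0\<close>; such cells cover a null set only.
\<close>

definition cell_average :: "nat \<Rightarrow> (real^'d \<Rightarrow> real) \<Rightarrow> real^'d \<Rightarrow> real" where
  "cell_average r f x = (\<integral>y. indicator (grid_cell r x) y * f y \<partial>\<rho>) / cell_mass r x"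

lemma indicator_measurable_pair [measurable]:
  "(\<lambda>(x, y). indicator (grid_cell r x) y :: real) \<in> borel_measurable (\<rho> \<Otimes>\<^sub>M \<rho>)"
proof -
  have "(\<lambda>(x, y). indicator (grid_cell r x) y :: real) = (\<lambda>p. if snd p \<in> grid_cell r (fst p) then 1 else 0)"
    by (auto simp: fun_eq_iff indicator_def)
  then show ?thesis by simp
qed

lemma indicator_measurable [measurable]:
  "(indicator (grid_cell r x) :: _ \<Rightarrow> real) \<in> borel_measurable \<rho>"
proof -
  have "(indicator (grid_cell r x) :: _ \<Rightarrow> real) = (\<lambda>y. if y \<in> grid_cell r x then 1 else 0)"
    by (auto simp: fun_eq_iff indicator_def)
  then show ?thesis by simp
qed

lemma indicator_integrable: "integrable \<rho> (indicator (grid_cell r x) :: _ \<Rightarrow> real)"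
  by (rule integrable_const_bound[where B=1]) auto

lemma indicator_L2: "(indicator (grid_cell r x) :: _ \<Rightarrow> real) \<in> L2_functions \<rho>"
  by (auto simp: L2_functions_def intro!: integrable_const_bound[where B=1] simp: indicator_def)

lemma cell_mass_nonneg: "cell_mass r x \<ge> 0"
  unfolding cell_mass_def by (intro Bochner_Integration.integral_nonneg) auto

lemma cell_mass_measurable [measurable]: "cell_mass r \<in> borel_measurable \<rho>"
  unfolding cell_mass_def
  by (rule borel_measurable_lebesgue_integral) (use indicator_measurable_pair in simp)

lemma cell_average_measurable:
  assumes [measurable]: "f \<in> borel_measurable \<rho>"
  shows "cell_average r f \<in> borel_measurable \<rho>"
proof -
  have "(\<lambda>(x, y). indicator (grid_cell r x) y * f y) \<in> borel_measurable (\<rho> \<Otimes>\<^sub>M \<rho>)"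
    using indicator_measurable_pair[of r] unfolding split_beta by measurable
  then have "(\<lambda>x. \<integral>y. indicator (grid_cell r x) y * f y \<partial>\<rho>) \<in> borel_measurable \<rho>"
    by (rule borel_measurable_lebesgue_integral)
  then show ?thesis
    unfolding cell_average_def by measurable
qed

text \<open>
  The points in null cells form a null set because there are countably many cells.
\<close>

lemma AE_cell_mass_pos: "AE x in \<rho>. \<forall>r. cell_mass r x > 0"
proof -
  have "AE x in \<rho>. (\<integral>y. (if grid_index r y = c then 1 else 0) \<partial>\<rho>) = (0::real) \<longrightarrow> grid_index r x \<noteq> c" for r c
  proof (cases "(\<integral>y. (if grid_index r y = c then 1 else 0) \<partial>\<rho>) = (0::real)")
    case True
    have int: "integrable \<rho> (\<lambda>y. if grid_index r y = c then 1 else 0 :: real)"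
      by (rule integrable_const_bound[where B=1]) auto
    have "AE y in \<rho>. (if grid_index r y = c then 1 else 0 :: real) = 0"
      using True integral_nonneg_eq_0_iff_AE[OF int] by simp
    then show ?thesis by eventually_elim (auto split: if_splits)
  qed simp
  then have "AE x in \<rho>. \<forall>r. \<forall>c :: int^'d. (\<integral>y. (if grid_index r y = c then 1 else 0) \<partial>\<rho>) = (0::real) \<longrightarrow> grid_index r x \<noteq> c"
    by (simp add: AE_all_countable)
  then show ?thesis
  proof eventually_elim
    case (elim x)
    show ?case
    proof
      fix r
      have "cell_mass r x = (\<integral>y. (if grid_index r y = grid_index r x then 1 else 0) \<partial>\<rho>)"
        unfolding cell_mass_def by (intro Bochner_Integration.integral_cong refl) (simp add: indicator_def grid_cell_def)
      then have "cell_mass r x \<noteq> 0" using elim by auto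
      then show "cell_mass r x > 0" using cell_mass_nonneg[of r x] by simp
    qed
  qed
qed

lemma cell_average_square_le:
  assumes f: "f \<in> L2_functions \<rho>"
  shows "(cell_average r f x)\<^sup>2 \<le> cell_average r (\<lambda>y. (f y)\<^sup>2) x"
proof (cases "cell_mass r x = 0")
  case True
  then show ?thesis by (simp add: cell_average_def)
next
  case False
  let ?I = "indicator (grid_cell r x) :: _ \<Rightarrow> real"
  define m where "m = cell_mass r x"
  define A where "A = (\<integral>y. ?I y * f y \<partial>\<rho>)"
  define B where "B = (\<integral>y. ?I y * (f y)\<^sup>2 \<partial>\<rho>)"
  have m: "m > 0" using False cell_mass_nonneg[of r x] by (simp add: m_def)
  have [measurable]: "f \<in> borel_measurable \<rho>" using f by (simp add: L2_functions_def)
  have i1: "integrable \<rho> (\<lambda>y. ?I y * f y)"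
    by (rule L2_functions_mult_integrable[OF indicator_L2 f])
  have i2: "integrable \<rho> (\<lambda>y. ?I y * (f y)\<^sup>2)"
  proof (rule Bochner_Integration.integrable_bound)
    show "integrable \<rho> (\<lambda>y. (f y)\<^sup>2)" using f by (simp add: L2_functions_def)
    show "AE y in \<rho>. norm (?I y * (f y)\<^sup>2) \<le> norm ((f y)\<^sup>2)"
      by (rule AE_I2) (simp add: indicator_def)
  qed measurable
  \<comment> \<open>This is \<open>m\<close> times the variance of \<open>f\<close> on the cell.\<close>
  have "0 \<le> (\<integral>y. ?I y * (f y - A / m)\<^sup>2 \<partial>\<rho>)"
    by (intro Bochner_Integration.integral_nonneg) auto
  also have "(\<integral>y. ?I y * (f y - A / m)\<^sup>2 \<partial>\<rho>) =
      (\<integral>y. ?I y * (f y)\<^sup>2 - 2 * (A / m) * (?I y * f y) + (A / m)\<^sup>2 * ?I y \<partial>\<rho>)"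
    by (intro Bochner_Integration.integral_cong refl) (simp add: power2_diff algebra_simps)
  also have "\<dots> = B - 2 * (A / m) * A + (A / m)\<^sup>2 * m"
    using i1 i2 indicator_integrable[of r x] by (simp add: A_def B_def m_def cell_mass_def)
  also have "\<dots> = B - A\<^sup>2 / m"
    using m by (simp add: field_simps power2_eq_square)
  finally have "A\<^sup>2 / m \<le> B" by simp
  then have "A\<^sup>2 / m / m \<le> B / m"
    using m by (intro divide_right_mono) auto
  then show ?thesis
    by (simp add: cell_average_def A_def B_def m_def power2_eq_square)
qed

text \<open>
  The averaging kernel \<open>indicator (grid_cell r x) y / cell_mass r x\<close> is symmetric in \<open>x\<close> and \<open>y\<close>, since
  points of the same cell have the same cell. By Tonelli's theorem the average may be taken over the other variable.
  This symmetry is the reason for averaging over the cells of a partition and not over balls.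
\<close>

lemma cell_average_nn_integral_le:
  assumes g: "integrable \<rho> g" "\<And>y. g y \<ge> 0"
  shows "(\<integral>\<^sup>+ x. ennreal (cell_average r g x) \<partial>\<rho>) \<le> (\<integral>\<^sup>+ x. ennreal (g x) \<partial>\<rho>)"
proof -
  interpret pair_sigma_finite \<rho> \<rho> ..
  have [measurable]: "g \<in> borel_measurable \<rho>" using g by simp
  have "integrable \<rho> (\<lambda>y. indicator (grid_cell r x) y * g y)" for x
  proof (rule Bochner_Integration.integrable_bound[OF g(1)])
    show "AE y in \<rho>. norm (indicator (grid_cell r x) y * g y) \<le> norm (g y)"
      by (rule AE_I2) (simp add: indicator_def)
  qed measurable
  then have mult: "integrable \<rho> (\<lambda>y. indicator (grid_cell r x) y * g y / cell_mass r x)" for x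
    by (rule integrable_divide)
  have "ennreal (cell_average r g x) = (\<integral>\<^sup>+ y. ennreal (indicator (grid_cell r x) y * g y / cell_mass r x) \<partial>\<rho>)" for x
    unfolding cell_average_def
    by (subst nn_integral_eq_integral[OF mult]) (auto simp: g cell_mass_nonneg)
  then have "(\<integral>\<^sup>+ x. ennreal (cell_average r g x) \<partial>\<rho>)
      = (\<integral>\<^sup>+ x. \<integral>\<^sup>+ y. ennreal (indicator (grid_cell r x) y * g y / cell_mass r x) \<partial>\<rho> \<partial>\<rho>)"
    by simp
  also have "\<dots> = (\<integral>\<^sup>+ y. \<integral>\<^sup>+ x. ennreal (indicator (grid_cell r x) y * g y / cell_mass r x) \<partial>\<rho> \<partial>\<rho>)"
  proof (rule Fubini'[symmetric])
    show "(\<lambda>(x, y). ennreal (indicator (grid_cell r x) y * g y / cell_mass r x)) \<in> borel_measurable (\<rho> \<Otimes>\<^sub>M \<rho>)"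
      using indicator_measurable_pair[of r] unfolding split_beta by measurable
  qed
  also have "\<dots> \<le> (\<integral>\<^sup>+ y. ennreal (g y) \<partial>\<rho>)"
  proof (rule nn_integral_mono)
    fix y
    have "indicator (grid_cell r x) y * g y / cell_mass r x = indicator (grid_cell r y) x * (g y / cell_mass r y)" for x
    proof (cases "y \<in> grid_cell r x")
      case True
      then have "grid_cell r y = grid_cell r x" "x \<in> grid_cell r y"
        using grid_cell_eq grid_cell_self by blast+
      with True show ?thesis by (simp add: cell_mass_def)
    next
      case False
      then show ?thesis using grid_cell_commute[of y r x] by simp
    qed
    then have "(\<integral>\<^sup>+ x. ennreal (indicator (grid_cell r x) y * g y / cell_mass r x) \<partial>\<rho>)
      = ennreal (\<integral>x. indicator (grid_cell r y) x * (g y / cell_mass r y) \<partial>\<rho>)"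
      using indicator_integrable[of r y]
      by (subst nn_integral_eq_integral[symmetric]) (auto simp: g cell_mass_nonneg)
    also have "\<dots> = ennreal (cell_mass r y * (g y / cell_mass r y))"
      by (simp add: cell_mass_def)
    also have "\<dots> \<le> ennreal (g y)"
      using g by (intro ennreal_leI) auto
    finally show "(\<integral>\<^sup>+ x. ennreal (indicator (grid_cell r x) y * g y / cell_mass r x) \<partial>\<rho>) \<le> ennreal (g y)" .
  qed
  finally show ?thesis .
qed

lemma cell_average_contraction:
  assumes f: "f \<in> L2_functions \<rho>"
  shows "(\<integral>\<^sup>+ x. ennreal ((cell_average r f x)\<^sup>2) \<partial>\<rho>) \<le> ennreal (L2_inner \<rho> f f)"
proof -
  have f2: "integrable \<rho> (\<lambda>y. (f y)\<^sup>2)" using f by (simp add: L2_functions_def)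
  have "(\<integral>\<^sup>+ x. ennreal ((cell_average r f x)\<^sup>2) \<partial>\<rho>) \<le> (\<integral>\<^sup>+ x. ennreal (cell_average r (\<lambda>y. (f y)\<^sup>2) x) \<partial>\<rho>)"
    by (intro nn_integral_mono ennreal_leI cell_average_square_le f)
  also have "\<dots> \<le> (\<integral>\<^sup>+ x. ennreal ((f x)\<^sup>2) \<partial>\<rho>)"
    by (rule cell_average_nn_integral_le[OF f2]) simp
  also have "\<dots> = ennreal (L2_inner \<rho> f f)"
    using nn_integral_eq_integral[OF f2] by (simp add: L2_inner_def power2_eq_square)
  finally show ?thesis .
qed

text \<open>
  The average of \<open>K\<close> over the product of the cells of \<open>x\<close> and \<open>y\<close>, as an iterated integral. It is written through the integral
  operator, since this is the object about which the eigen-decomposition speaks.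
\<close>

definition kernel_cell_average :: "(real^'d \<Rightarrow> real^'d \<Rightarrow> real) \<Rightarrow> nat \<Rightarrow> real^'d \<Rightarrow> real^'d \<Rightarrow> real" where
  "kernel_cell_average K r x y =
     L2_inner \<rho> (indicator (grid_cell r x)) (integral_operator \<rho> K (indicator (grid_cell r y)))
       / (cell_mass r x * cell_mass r y)"

text \<open>
  Parseval's identity for the indicators of the two cells.
\<close>

lemma kernel_cell_average_series:
  assumes eigen: "eigen_decomposition \<rho> K \<mu> \<phi>"
  shows "(\<lambda>L. \<Sum>j<L. \<mu> j * cell_average r (\<phi> j) x * cell_average r (\<phi> j) y) \<longlonglongrightarrow> kernel_cell_average K r x y"
proof -
  let ?f = "indicator (grid_cell r y) :: _ \<Rightarrow> real"
  let ?h = "indicator (grid_cell r x) :: _ \<Rightarrow> real"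
  have \<phi>: "\<phi> j \<in> L2_functions \<rho>" for j
    using eigen by (simp add: eigen_decomposition_def L2_orthonormal_basis_def)
  have Kf: "integral_operator \<rho> K ?f \<in> L2_functions \<rho>"
    using eigen indicator_L2 by (simp add: eigen_decomposition_def L2_operator_def)
  have sums: "L2_sums \<rho> (\<lambda>j z. \<mu> j * L2_inner \<rho> (\<phi> j) ?f * \<phi> j z) (integral_operator \<rho> K ?f)"
    using eigen indicator_L2 by (simp add: eigen_decomposition_def)
  have "(\<lambda>L. \<Sum>j<L. L2_inner \<rho> ?h (\<lambda>z. \<mu> j * L2_inner \<rho> (\<phi> j) ?f * \<phi> j z))
      \<longlonglongrightarrow> L2_inner \<rho> ?h (integral_operator \<rho> K ?f)"
    by (rule L2_sums_inner[OF sums]) (auto simp: indicator_def intro!: Kf L2_functions_scale \<phi>)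
  moreover have "L2_inner \<rho> ?h (\<lambda>z. \<mu> j * L2_inner \<rho> (\<phi> j) ?f * \<phi> j z)
      = \<mu> j * L2_inner \<rho> ?f (\<phi> j) * L2_inner \<rho> ?h (\<phi> j)" for j
  proof -
    have "L2_inner \<rho> ?h (\<lambda>z. \<mu> j * L2_inner \<rho> (\<phi> j) ?f * \<phi> j z) =
        (\<integral>z. (\<mu> j * L2_inner \<rho> (\<phi> j) ?f) * (?h z * \<phi> j z) \<partial>\<rho>)"
      unfolding L2_inner_def by (intro Bochner_Integration.integral_cong refl) (simp add: mult_ac)
    also have "\<dots> = \<mu> j * L2_inner \<rho> (\<phi> j) ?f * L2_inner \<rho> ?h (\<phi> j)"
      by (simp add: L2_inner_def)
    finally show ?thesis by (simp add: L2_inner_def mult.commute)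
  qed
  ultimately have "(\<lambda>L. (\<Sum>j<L. \<mu> j * L2_inner \<rho> ?f (\<phi> j) * L2_inner \<rho> ?h (\<phi> j)) * (1 / (cell_mass r x * cell_mass r y)))
      \<longlonglongrightarrow> L2_inner \<rho> ?h (integral_operator \<rho> K ?f) * (1 / (cell_mass r x * cell_mass r y))"
    by (intro tendsto_mult_right) simp
  moreover have "(\<Sum>j<L. \<mu> j * L2_inner \<rho> ?f (\<phi> j) * L2_inner \<rho> ?h (\<phi> j)) * (1 / (cell_mass r x * cell_mass r y))
      = (\<Sum>j<L. \<mu> j * cell_average r (\<phi> j) x * cell_average r (\<phi> j) y)" for L
    unfolding sum_distrib_right
    by (intro sum.cong refl) (simp add: cell_average_def L2_inner_def)
  ultimately show ?thesis
    by (simp add: kernel_cell_average_def)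
qed

lemma cell_integral_close:
  assumes meas: "(\<lambda>y. indicator (grid_cell r x) y * u y) \<in> borel_measurable \<rho>"
    and close: "\<And>y. y \<in> S \<Longrightarrow> y \<in> grid_cell r x \<Longrightarrow> \<bar>u y - k\<bar> \<le> e"
  shows "\<bar>(\<integral>y. indicator (grid_cell r x) y * u y \<partial>\<rho>) - k * cell_mass r x\<bar> \<le> e * cell_mass r x"
proof -
  let ?I = "indicator (grid_cell r x) :: _ \<Rightarrow> real"
  have bound: "\<bar>?I y * u y\<bar> \<le> \<bar>e\<bar> + \<bar>k\<bar>" if "y \<in> S" for y
    using close[OF that] by (cases "y \<in> grid_cell r x") auto
  have int: "integrable \<rho> (\<lambda>y. ?I y * u y)"
    by (rule integrable_const_bound[where B="\<bar>e\<bar> + \<bar>k\<bar>"]) (auto simp: meas bound space_eq intro!: AE_I2)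
  have close': "\<bar>?I y * u y - k * ?I y\<bar> \<le> e * ?I y" if "y \<in> S" for y
    using close[OF that] by (cases "y \<in> grid_cell r x") auto
  have int2: "integrable \<rho> (\<lambda>y. ?I y * u y - k * ?I y)" and int3: "integrable \<rho> (\<lambda>y. e * ?I y)"
    using int indicator_integrable by auto
  have "\<bar>\<integral>y. ?I y * u y - k * ?I y \<partial>\<rho>\<bar> \<le> (\<integral>y. e * ?I y \<partial>\<rho>)"
    using int2 int3 close'
    by (intro order_trans[OF integral_abs_bound] integral_mono integrable_abs) (auto simp: space_eq)
  then show ?thesis
    using int indicator_integrable[of r x] by (simp add: cell_mass_def)
qed

lemma kernel_cell_average_tendsto:
  assumes L2: "L2_operator \<rho> K" and cont: "continuous_on (S \<times> S) (\<lambda>(x, y). K x y)"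
    and x: "x \<in> S" "\<And>r. cell_mass r x > 0" and y: "y \<in> S" "\<And>r. cell_mass r y > 0"
  shows "(\<lambda>r. kernel_cell_average K r x y) \<longlonglongrightarrow> K x y"
proof (rule LIMSEQ_I)
  fix e :: real assume e: "e > 0"
  have "\<exists>\<delta>>0. \<forall>p\<in>S \<times> S. dist p (x, y) < \<delta> \<longrightarrow> dist ((\<lambda>(x, y). K x y) p) (K x y) < e / 2"
    using continuous_on_iff[THEN iffD1, OF cont, rule_format, of "(x, y)" "e / 2"] x(1) y(1) e by simp
  then obtain \<delta> where \<delta>: "\<delta> > 0"
    "\<And>s t. s \<in> S \<Longrightarrow> t \<in> S \<Longrightarrow> dist (s, t) (x, y) < \<delta> \<Longrightarrow> \<bar>K s t - K x y\<bar> < e / 2"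
    by (auto simp: dist_real_def)
  have "(\<lambda>r. real CARD('d) * (1 / 2) ^ r) \<longlonglongrightarrow> real CARD('d) * 0"
    by (intro tendsto_mult_left LIMSEQ_realpow_zero) auto
  then have "\<forall>\<^sub>F r in sequentially. real CARD('d) * (1 / 2) ^ r < \<delta> / 2"
    using \<delta>(1) by (intro order_tendstoD(2)[where y=0]) auto
  then obtain r0 where r0: "\<And>r. r \<ge> r0 \<Longrightarrow> real CARD('d) / 2 ^ r < \<delta> / 2"
    by (auto simp: eventually_sequentially power_one_over)
  have cont_section: "K s \<in> borel_measurable \<rho>" if "s \<in> S" for s
  proof -
    have "continuous_on S ((\<lambda>(x, y). K x y) \<circ> (\<lambda>t. (s, t)))"
      using that by (intro continuous_on_compose continuous_intros continuous_on_subset[OF cont]) auto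
    then have "K s \<in> borel_measurable (restrict_space borel S)"
      by (intro borel_measurable_continuous_on_restrict) (simp add: o_def)
    then show ?thesis using measurable_cong_sets[OF sets_eq refl] by blast
  qed
  show "\<exists>r0. \<forall>r\<ge>r0. norm (kernel_cell_average K r x y - K x y) < e"
  proof (intro exI allI impI)
    fix r assume r: "r0 \<le> r"
    let ?f = "indicator (grid_cell r y) :: _ \<Rightarrow> real"
    have near: "\<bar>K s t - K x y\<bar> \<le> e / 2" if "s \<in> S" "t \<in> S" "s \<in> grid_cell r x" "t \<in> grid_cell r y" for s t
    proof -
      have "dist (s, t) (x, y) \<le> dist s x + dist t y"
        unfolding dist_prod_def by (simp add: sqrt_sum_squares_le_sum)
      also have "\<dots> < \<delta>"
        using dist_grid_cell[OF that(3)] dist_grid_cell[OF that(4)] r0[OF r] by linarith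
      finally show ?thesis using \<delta>(2)[OF that(1,2)] by force
    qed
    have inner: "\<bar>integral_operator \<rho> K ?f s - K x y * cell_mass r y\<bar> \<le> e / 2 * cell_mass r y"
      if "s \<in> S" "s \<in> grid_cell r x" for s
    proof -
      have [measurable]: "K s \<in> borel_measurable \<rho>" by (rule cont_section[OF that(1)])
      have "\<bar>(\<integral>t. ?f t * K s t \<partial>\<rho>) - K x y * cell_mass r y\<bar> \<le> e / 2 * cell_mass r y"
        using that by (intro cell_integral_close near) auto
      then show ?thesis by (simp add: integral_operator_def mult.commute)
    qed
    have [measurable]: "integral_operator \<rho> K ?f \<in> borel_measurable \<rho>"
      using L2 indicator_L2[of r y] by (simp add: L2_operator_def L2_functions_def)
    have "\<bar>L2_inner \<rho> (indicator (grid_cell r x)) (integral_operator \<rho> K ?f) - K x y * cell_mass r y * cell_mass r x\<bar>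
        \<le> e / 2 * cell_mass r y * cell_mass r x"
      unfolding L2_inner_def by (intro cell_integral_close inner) auto
    then have "\<bar>L2_inner \<rho> (indicator (grid_cell r x)) (integral_operator \<rho> K ?f) - K x y * cell_mass r y * cell_mass r x\<bar>
        / (cell_mass r x * cell_mass r y) \<le> e / 2"
      using x(2)[of r] y(2)[of r] by (simp add: divide_le_eq mult_ac)
    moreover have "kernel_cell_average K r x y - K x y =
      (L2_inner \<rho> (indicator (grid_cell r x)) (integral_operator \<rho> K ?f) - K x y * cell_mass r y * cell_mass r x)
        / (cell_mass r x * cell_mass r y)"
      using x(2)[of r] y(2)[of r] by (simp add: kernel_cell_average_def field_simps)
    ultimately have "\<bar>kernel_cell_average K r x y - K x y\<bar> \<le> e / 2"
      using x(2)[of r] y(2)[of r] by (simp only: abs_divide abs_mult abs_of_pos)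
    then show "norm (kernel_cell_average K r x y - K x y) < e"
      using e by simp
  qed
qed

end

section \<open>Noise and design\<close>

text \<open>
  A random variable that depends on \<open>f (X i)\<close> becomes a Borel function of \<open>X i\<close> itself, so that independence,
  which is stated for the Borel sets of the whole space, can be used.
\<close>

lemma borel_measurable_extension:
  fixes f :: "'a::topological_space \<Rightarrow> real"
  assumes f: "f \<in> borel_measurable (restrict_space borel S)"
  obtains F where "F \<in> borel_measurable borel" "\<And>x. x \<in> S \<Longrightarrow> F x = f x"
proof -
  have "\<exists>B\<in>sets borel. {x \<in> S. f x < real_of_rat q} = S \<inter> B" for q
  proof -
    have "{x \<in> space (restrict_space borel S). f x < real_of_rat q} \<in> sets (restrict_space borel S)"
      using f by measurable
    then show ?thesis
      by (auto simp: sets_restrict_space space_restrict_space)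
  qed
  then obtain B where B: "\<And>q. B q \<in> sets borel" "\<And>q. {x \<in> S. f x < real_of_rat q} = S \<inter> B q"
    by metis
  \<comment> \<open>On \<open>S\<close> this is the infimum of the rational numbers above \<open>f x\<close>.\<close>
  define F where "F x = (INF q. if x \<in> B q then ereal (real_of_rat q) else \<infinity>)" for x
  note [measurable] = B(1)
  have "(\<lambda>x. real_of_ereal (F x)) \<in> borel_measurable borel"
    unfolding F_def by measurable
  moreover have "F x = ereal (f x)" if x: "x \<in> S" for x
  proof -
    have mem: "x \<in> B q \<longleftrightarrow> f x < real_of_rat q" for q
      using B(2)[of q] x by blast
    have "F x \<le> z" if "ereal (f x) < z" for z
    proof -
      have "\<exists>y. f x < y \<and> ereal y \<le> z"
      proof (cases z)
        case (real r)
        then show ?thesis using that by (intro exI[of _ r]) simp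
      next
        case PInf
        then show ?thesis by (intro exI[of _ "f x + 1"]) simp
      next
        case MInf
        then show ?thesis using that by simp
      qed
      then obtain y where y: "f x < y" "ereal y \<le> z" by blast
      obtain q where "f x < real_of_rat q" "real_of_rat q < y"
        using of_rat_dense[OF y(1)] by blast
      with y(2) have "f x < real_of_rat q" "ereal (real_of_rat q) \<le> z"
        by (auto intro: order_trans[of _ "ereal y"])
      then show ?thesis
        unfolding F_def by (intro INF_lower2[of q]) (auto simp: mem)
    qed
    then have "F x \<le> ereal (f x)" by (rule dense_ge)
    moreover have "ereal (f x) \<le> F x"
      unfolding F_def by (rule INF_greatest) (auto simp: mem)
    ultimately show ?thesis by (rule antisym)
  qed
  ultimately show ?thesis
    by (intro that[of "\<lambda>x. real_of_ereal (F x)"]) auto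
qed

lemma (in prob_space) integral_mult_eq_0:
  fixes W :: "'a \<Rightarrow> real"
  assumes sub: "subalgebra M F"
    and W: "integrable M W" "\<And>A. A \<in> sets F \<Longrightarrow> (\<integral>w. indicator A w * W w \<partial>M) = 0"
    and h: "h \<in> borel_measurable F" "integrable M (\<lambda>w. h w * W w)"
  shows "(\<integral>w. h w * W w \<partial>M) = 0"
proof -
  interpret sigma_finite_subalgebra M F
    using sub by (rule finite_measure_subalgebra_is_sigma_finite[OF finite_measure_subalgebra.intro, OF finite_measure_axioms finite_measure_subalgebra_axioms.intro])
  have "AE w in M. real_cond_exp M F W w = (\<lambda>_. 0) w"
    by (rule real_cond_exp_charact) (auto simp: W set_lebesgue_integral_def)
  then have "(\<integral>w. h w * real_cond_exp M F W w \<partial>M) = (\<integral>w. 0 \<partial>M)"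
    using h(1) by (intro integral_cong_AE) (auto intro: measurable_from_subalg[OF sub])
  moreover have "(\<integral>w. h w * real_cond_exp M F W w \<partial>M) = (\<integral>w. h w * W w \<partial>M)"
    using real_cond_exp_intg(2)[OF h(2) h(1)] W(1) by simp
  ultimately show ?thesis by simp
qed

context random_design
begin

lemma X_borel [measurable]: "X i \<in> borel_measurable M"
  using X_measurable[of i] by (simp add: measurable_restrict_space2_iff)

lemma X_in_S: "w \<in> space M \<Longrightarrow> X i w \<in> S"
  using measurable_space[OF X_measurable[of i], of w] by (simp add: space_restrict_space)

lemma sets_\<rho>: "sets \<rho> = sets (restrict_space borel S)"
  using X_distr[of undefined] by (metis sets_distr)

lemma Y_borel [measurable]: "Y i \<in> borel_measurable M"
proof -
  have "(\<lambda>w. (X i w, Y i w)) \<in> borel_measurable M"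
    using indep by (auto simp: indep_vars_def)
  from measurable_compose[OF this, of snd borel] show ?thesis
    by (simp add: borel_prod[symmetric])
qed

text \<open>
  An intersection stable generator of the sigma-algebra of the whole design, made of the events
  whose probabilities factorize by independence.
\<close>

definition design_events :: "'w set set" where
  "design_events = {{w \<in> space M. \<forall>i. X i w \<in> B i} | B. \<forall>i. B i \<in> sets borel}"

definition design_algebra :: "'w measure" where
  "design_algebra = sigma (space M) design_events"

lemma design_events_subset: "design_events \<subseteq> Pow (space M)"
  by (auto simp: design_events_def)

lemma space_design_algebra: "space design_algebra = space M"
  and sets_design_algebra: "sets design_algebra = sigma_sets (space M) design_events"
  using design_events_subset by (simp_all add: design_algebra_def)

lemma design_events_measurable: "A \<in> design_events \<Longrightarrow> A \<in> sets M"
  unfolding design_events_def by auto measurable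

lemma subalgebra_design: "subalgebra M design_algebra"
  unfolding subalgebra_def
  using sets.sigma_sets_subset[of design_events M] design_events_measurable
  by (auto simp: space_design_algebra sets_design_algebra)

lemma Int_stable_design_events: "Int_stable design_events"
proof (rule Int_stableI)
  fix a b assume "a \<in> design_events" "b \<in> design_events"
  then obtain A B where AB: "a = {w \<in> space M. \<forall>i. X i w \<in> A i}" "b = {w \<in> space M. \<forall>i. X i w \<in> B i}"
      "\<And>i. A i \<in> sets borel" "\<And>i. B i \<in> sets borel"
    by (auto simp: design_events_def)
  then show "a \<inter> b \<in> design_events"
    unfolding design_events_def by (auto intro!: exI[where x="\<lambda>i. A i \<inter> B i"])
qed

lemma X_measurable_design: "X i \<in> measurable design_algebra (restrict_space borel S)"
proof -
  have "X i \<in> measurable design_algebra borel"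
  proof (rule measurableI)
    fix B :: "(real^'d) set" assume B: "B \<in> sets borel"
    have "X i -` B \<inter> space design_algebra = {w \<in> space M. \<forall>k. X k w \<in> (if k = i then B else UNIV)}"
      by (auto simp: space_design_algebra)
    also have "\<dots> \<in> design_events"
      unfolding design_events_def using B by (intro CollectI exI[where x="\<lambda>k. if k = i then B else UNIV"]) auto
    finally show "X i -` B \<inter> space design_algebra \<in> sets design_algebra"
      by (simp add: sets_design_algebra sigma_sets.Basic)
  qed simp
  then show ?thesis
    using X_in_S by (intro measurable_restrict_space2) (auto simp: space_design_algebra)
qed

text \<open>
  On an event from the generator the integral factorizes by independence, and the factor with index \<open>k\<close>
  vanishes. Dynkin's theorem extends this to all events that depend on the design. Taking for \<open>z i\<close> noise variables or the
  constant \<open>1\<close>, this passes from conditioning on one design point to conditioning on the whole design.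
\<close>

lemma integral_indicator_prod_eq_0:
  fixes z :: "'n \<Rightarrow> (real^'d) \<times> real \<Rightarrow> real"
  assumes z: "\<And>i. z i \<in> borel_measurable borel" "\<And>i. integrable M (\<lambda>w. z i (X i w, Y i w))"
    and zero: "\<And>B. B \<in> sets borel \<Longrightarrow> (\<integral>w. indicator B (X k w) * z k (X k w, Y k w) \<partial>M) = 0"
    and A: "A \<in> sets design_algebra"
  shows "(\<integral>w. indicator A w * (\<Prod>i\<in>UNIV. z i (X i w, Y i w)) \<partial>M) = 0"
    and "integrable M (\<lambda>w. \<Prod>i\<in>UNIV. z i (X i w, Y i w))"
proof -
  define W where "W w = (\<Prod>i\<in>UNIV. z i (X i w, Y i w))" for w
  have indep_comp: "indep_vars (\<lambda>_. borel) (\<lambda>i w. indicator (B i) (X i w) * z i (X i w, Y i w)) UNIV"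
    if "\<And>i. B i \<in> sets borel" for B
  proof -
    have [measurable]: "(\<lambda>p. indicator (B i) (fst p) * z i p) \<in> borel_measurable borel" for i
    proof -
      have "(\<lambda>p. indicator (B i) (fst p) :: real) \<in> borel_measurable borel"
        using that by (intro measurable_compose[OF borel_measurable_continuous_onI[of fst]] continuous_on_fst continuous_on_id) simp
      then show ?thesis by (intro borel_measurable_times z(1))
    qed
    show ?thesis
      using indep_vars_compose2[OF indep, where Y="\<lambda>i p. indicator (B i) (fst p) * z i p" and N="\<lambda>_. borel"]
      by simp
  qed
  have int_comp: "integrable M (\<lambda>w. indicator (B i) (X i w) * z i (X i w, Y i w))"
    if "\<And>i. B i \<in> sets borel" for B i
  proof -
    have "{w \<in> space M. X i w \<in> B i} \<in> sets M" using that by measurable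
    then have "integrable M (\<lambda>w. indicator {w \<in> space M. X i w \<in> B i} w * z i (X i w, Y i w))"
      using integrable_mult_indicator[OF _ z(2)] by simp
    moreover have "indicator {w \<in> space M. X i w \<in> B i} w = (indicator (B i) (X i w) :: real)" if "w \<in> space M" for w
      using that by (simp add: indicator_def)
    ultimately show ?thesis
      by (subst Bochner_Integration.integrable_cong[OF refl, where g="\<lambda>w. indicator {w \<in> space M. X i w \<in> B i} w * z i (X i w, Y i w)"]) auto
  qed
  have rect: "(\<integral>w. indicator {w \<in> space M. \<forall>i. X i w \<in> B i} w * W w \<partial>M) = 0"
    if B: "\<And>i. B i \<in> sets borel" for B
  proof -
    have "indicator {w \<in> space M. \<forall>i. X i w \<in> B i} w * W w = (\<Prod>i\<in>UNIV. indicator (B i) (X i w) * z i (X i w, Y i w))"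
      if "w \<in> space M" for w
    proof (cases "\<forall>i. X i w \<in> B i")
      case True
      with that show ?thesis by (simp add: W_def)
    next
      case False
      then obtain i where "X i w \<notin> B i" by auto
      then have "(\<Prod>i\<in>UNIV. indicator (B i) (X i w) * z i (X i w, Y i w)) = 0"
        by (intro prod_zero bexI[where x=i]) auto
      with False show ?thesis by simp
    qed
    then have "(\<integral>w. indicator {w \<in> space M. \<forall>i. X i w \<in> B i} w * W w \<partial>M)
        = (\<integral>w. (\<Prod>i\<in>UNIV. indicator (B i) (X i w) * z i (X i w, Y i w)) \<partial>M)"
      by (intro Bochner_Integration.integral_cong) auto
    also have "\<dots> = (\<Prod>i\<in>UNIV. \<integral>w. indicator (B i) (X i w) * z i (X i w, Y i w) \<partial>M)"
      by (intro indep_vars_lebesgue_integral indep_comp int_comp B) auto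
    also have "\<dots> = 0"
      using zero[OF B] by (intro prod_zero bexI[where x=k]) auto
    finally show ?thesis .
  qed
  have int: "integrable M W"
    using indep_vars_integrable[OF _ indep_comp[of "\<lambda>_. UNIV"] int_comp[of "\<lambda>_. UNIV"]] by (simp add: W_def[abs_def])
  have total: "(\<integral>w. W w \<partial>M) = 0"
  proof -
    have "(\<integral>w. W w \<partial>M) = (\<integral>w. indicator {w \<in> space M. \<forall>i. X i w \<in> UNIV} w * W w \<partial>M)"
      by (intro Bochner_Integration.integral_cong) auto
    then show ?thesis using rect[of "\<lambda>_. UNIV"] by simp
  qed
  have int_ind: "integrable M (\<lambda>w. indicator A w * W w)" if "A \<in> sets M" for A
    using integrable_mult_indicator[OF that int] by simp
  have sub: "A \<in> sets M" if "A \<in> sigma_sets (space M) design_events" for A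
    using that subalgebra_design by (auto simp: subalgebra_def sets_design_algebra)
  have "A \<in> sigma_sets (space M) design_events" using A by (simp add: sets_design_algebra)
  from Int_stable_design_events design_events_subset this
  have "(\<integral>w. indicator A w * W w \<partial>M) = 0"
  proof (induction rule: sigma_sets_induct_disjoint)
    case (basic A)
    then show ?case using rect by (auto simp: design_events_def)
  next
    case empty
    then show ?case by simp
  next
    case (compl A)
    have "(\<integral>w. indicator (space M - A) w * W w \<partial>M) = (\<integral>w. W w - indicator A w * W w \<partial>M)"
      by (intro Bochner_Integration.integral_cong) (auto simp: indicator_def)
    also have "\<dots> = 0"
      using int int_ind[OF sub[OF compl(1)]] compl(2) by (simp add: total)
    finally show ?case .
  next
    case (union A)
    have meas: "A i \<in> sets M" for i using union(2) sub by auto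
    have "(LINT w:(\<Union>i. A i)|M. W w) = (\<Sum>i. LINT w:A i|M. W w)"
      using union(1) meas int_ind[of "\<Union>i. A i"]
      by (intro lebesgue_integral_countable_add) (auto simp: disjoint_family_on_def set_integrable_def)
    then show ?case
      using union(3) by (simp add: set_lebesgue_integral_def)
  qed
  then show "(\<integral>w. indicator A w * (\<Prod>i\<in>UNIV. z i (X i w, Y i w)) \<partial>M) = 0"
    by (simp add: W_def)
  show "integrable M (\<lambda>w. \<Prod>i\<in>UNIV. z i (X i w, Y i w))"
    using int by (simp add: W_def[abs_def])
qed

lemma fstar_X_measurable:
  assumes "\<And>i. X i \<in> measurable N (restrict_space borel S)"
  shows "(\<lambda>w. fstar (X i w)) \<in> borel_measurable N"
proof -
  have "fstar \<in> borel_measurable (restrict_space borel S)"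
    using fstar_measurable measurable_cong_sets[OF sets_\<rho> refl] by blast
  then show ?thesis by (rule measurable_compose[OF assms])
qed

lemma noise_borel [measurable]: "\<epsilon> i \<in> borel_measurable M"
proof -
  have "(\<lambda>w. Y i w - fstar (X i w)) \<in> borel_measurable M"
    using fstar_X_measurable[of M i, OF X_measurable] by measurable
  moreover have "\<epsilon> i w = Y i w - fstar (X i w)" if "w \<in> space M" for w
    using regression[OF that] by simp
  ultimately show ?thesis
    by (subst measurable_cong) auto
qed

lemma noise_integrable: "integrable M (\<epsilon> i)"
  by (rule square_integrable_imp_integrable[OF noise_borel noise_square_integrable])

lemma integral_indicator_cond_exp:
  assumes f: "integrable M f" and B: "B \<in> sets borel"
    and ce: "AE w in M. real_cond_exp M (vimage_algebra (space M) (X k) borel) f w = m"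
  shows "(\<integral>w. indicator B (X k w) * f w \<partial>M) = (\<integral>w. indicator B (X k w) * m \<partial>M)"
proof -
  let ?F = "vimage_algebra (space M) (X k) borel"
  have sub: "subalgebra M ?F"
    unfolding subalgebra_def by (auto simp: sets_vimage_algebra2)
  interpret finite_measure_subalgebra M ?F
    by standard (rule sub)
  have ind: "(\<lambda>w. indicator B (X k w) :: real) \<in> borel_measurable ?F"
    using B by (intro measurable_compose[OF measurable_vimage_algebra1]) auto
  have "integrable M (\<lambda>w. indicator B (X k w) * f w)"
  proof (rule Bochner_Integration.integrable_bound[OF f])
    show "(\<lambda>w. indicator B (X k w) * f w) \<in> borel_measurable M"
      using measurable_from_subalg[OF sub ind] f by simp
  qed (auto simp: indicator_def)
  from real_cond_exp_intg(2)[OF this ind] f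
  have "(\<integral>w. indicator B (X k w) * f w \<partial>M) = (\<integral>w. indicator B (X k w) * real_cond_exp M ?F f w \<partial>M)"
    by simp
  also have "\<dots> = (\<integral>w. indicator B (X k w) * m \<partial>M)"
    using ce measurable_from_subalg[OF sub ind] by (intro integral_cong_AE) auto
  finally show ?thesis .
qed

lemma noise_indicator_eq_0:
  assumes "B \<in> sets borel"
  shows "(\<integral>w. indicator B (X k w) * \<epsilon> k w \<partial>M) = 0"
    and "(\<integral>w. indicator B (X k w) * ((\<epsilon> k w)\<^sup>2 - \<sigma>\<^sup>2) \<partial>M) = 0"
proof -
  show "(\<integral>w. indicator B (X k w) * \<epsilon> k w \<partial>M) = 0"
    using integral_indicator_cond_exp[OF noise_integrable assms noise_cond_mean] by simp
  have [measurable]: "{w \<in> space M. X k w \<in> B} \<in> sets M"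
    using assms by measurable
  have int: "integrable M (\<lambda>w. indicator B (X k w) * f w)" if f: "integrable M f" for f :: "'w \<Rightarrow> real"
  proof (rule Bochner_Integration.integrable_bound[OF f])
    have "(\<lambda>w. indicator B (X k w) :: real) \<in> borel_measurable M"
      using assms by measurable
    then show "(\<lambda>w. indicator B (X k w) * f w) \<in> borel_measurable M"
      using f by simp
  qed (auto simp: indicator_def)
  show "(\<integral>w. indicator B (X k w) * ((\<epsilon> k w)\<^sup>2 - \<sigma>\<^sup>2) \<partial>M) = 0"
    using integral_indicator_cond_exp[OF noise_square_integrable assms noise_cond_variance]
      int[OF noise_square_integrable] int[of "\<lambda>_. \<sigma>\<^sup>2"]
    by (simp add: right_diff_distrib)
qed

text \<open>
  In terms of conditional expectations given the whole design: the noise variables have mean \<open>0\<close>, are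
  uncorrelated and have second moment \<open>\<sigma>\<^sup>2\<close>.
\<close>

lemma noise_orthogonal_to_design:
  assumes h: "h \<in> borel_measurable design_algebra"
  shows "integrable M (\<lambda>w. h w * \<epsilon> k w) \<Longrightarrow> (\<integral>w. h w * \<epsilon> k w \<partial>M) = 0"
    and "k \<noteq> l \<Longrightarrow> integrable M (\<lambda>w. h w * (\<epsilon> k w * \<epsilon> l w)) \<Longrightarrow> (\<integral>w. h w * (\<epsilon> k w * \<epsilon> l w) \<partial>M) = 0"
    and "integrable M (\<lambda>w. h w * ((\<epsilon> k w)\<^sup>2 - \<sigma>\<^sup>2)) \<Longrightarrow> (\<integral>w. h w * ((\<epsilon> k w)\<^sup>2 - \<sigma>\<^sup>2) \<partial>M) = 0"
proof -
  obtain F where F: "F \<in> borel_measurable borel" "\<And>x. x \<in> S \<Longrightarrow> F x = fstar x"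
    using fstar_measurable measurable_cong_sets[OF sets_\<rho> refl] borel_measurable_extension by blast
  have \<epsilon>: "\<epsilon> i w = Y i w - F (X i w)" if "w \<in> space M" for i w
    using regression[OF that] F(2)[OF X_in_S[OF that]] by simp
  \<comment> \<open>The noise as a Borel function of a single observation.\<close>
  define e :: "(real^'d) \<times> real \<Rightarrow> real" where "e p = snd p - F (fst p)" for p
  have e: "e \<in> borel_measurable borel"
    unfolding e_def borel_prod[symmetric] using F(1) by measurable
  have \<epsilon>_eq: "\<epsilon> i w = e (X i w, Y i w)" if "w \<in> space M" for i w
    using that by (simp add: \<epsilon> e_def)
  have if_borel: "(\<lambda>p. if b then f p else 1) \<in> borel_measurable borel"
    if "f \<in> borel_measurable borel" for b and f :: "(real^'d) \<times> real \<Rightarrow> real"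
    using that by (cases b) auto
  have if_integrable: "integrable M (\<lambda>w. if b then f w else 1)" if "integrable M f" for b and f :: "'w \<Rightarrow> real"
    using that by (cases b) auto
  have zero: "(\<integral>w. h w * W w \<partial>M) = 0"
    if z: "\<And>i. z i \<in> borel_measurable borel" "\<And>i. integrable M (\<lambda>w. z i (X i w, Y i w))"
      and B: "\<And>B. B \<in> sets borel \<Longrightarrow> (\<integral>w. indicator B (X k w) * z k (X k w, Y k w) \<partial>M) = 0"
      and W: "\<And>w. w \<in> space M \<Longrightarrow> W w = (\<Prod>i\<in>UNIV. z i (X i w, Y i w))"
      and int: "integrable M (\<lambda>w. h w * W w)" for z W k
  proof -
    have "(\<integral>w. h w * (\<Prod>i\<in>UNIV. z i (X i w, Y i w)) \<partial>M) = 0"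
    proof (rule integral_mult_eq_0[OF subalgebra_design _ _ h])
      show "integrable M (\<lambda>w. \<Prod>i\<in>UNIV. z i (X i w, Y i w))"
        using integral_indicator_prod_eq_0(2)[OF z B sets.empty_sets] .
      show "(\<integral>w. indicator A w * (\<Prod>i\<in>UNIV. z i (X i w, Y i w)) \<partial>M) = 0" if "A \<in> sets design_algebra" for A
        using integral_indicator_prod_eq_0(1)[OF z B that] .
      show "integrable M (\<lambda>w. h w * (\<Prod>i\<in>UNIV. z i (X i w, Y i w)))"
        using int by (subst Bochner_Integration.integrable_cong[OF refl, where g="\<lambda>w. h w * W w"]) (auto simp: W)
    qed
    moreover have "(\<integral>w. h w * W w \<partial>M) = (\<integral>w. h w * (\<Prod>i\<in>UNIV. z i (X i w, Y i w)) \<partial>M)"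
      by (intro Bochner_Integration.integral_cong) (auto simp: W)
    ultimately show ?thesis by simp
  qed
  have e_int: "integrable M (\<lambda>w. e (X i w, Y i w))" for i
    using noise_integrable[of i]
    by (subst Bochner_Integration.integrable_cong[OF refl, where g="\<epsilon> i"]) (auto simp: \<epsilon> e_def)
  have e_ind: "(\<integral>w. indicator B (X i w) * e (X i w, Y i w) \<partial>M) = 0" if "B \<in> sets borel" for B i
    using noise_indicator_eq_0(1)[OF that, of i]
    by (subst Bochner_Integration.integral_cong[OF refl, where g="\<lambda>w. indicator B (X i w) * \<epsilon> i w"]) (auto simp: \<epsilon> e_def)
  have e2_int: "integrable M (\<lambda>w. (e (X i w, Y i w))\<^sup>2 - \<sigma>\<^sup>2)" for i
    using noise_square_integrable[of i]
    by (subst Bochner_Integration.integrable_cong[OF refl, where g="\<lambda>w. (\<epsilon> i w)\<^sup>2 - \<sigma>\<^sup>2"]) (auto simp: \<epsilon> e_def)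
  have e2_ind: "(\<integral>w. indicator B (X i w) * ((e (X i w, Y i w))\<^sup>2 - \<sigma>\<^sup>2) \<partial>M) = 0" if "B \<in> sets borel" for B i
    using noise_indicator_eq_0(2)[OF that, of i]
    by (subst Bochner_Integration.integral_cong[OF refl, where g="\<lambda>w. indicator B (X i w) * ((\<epsilon> i w)\<^sup>2 - \<sigma>\<^sup>2)"]) (auto simp: \<epsilon> e_def)
  show "(\<integral>w. h w * \<epsilon> k w \<partial>M) = 0" if "integrable M (\<lambda>w. h w * \<epsilon> k w)"
    by (rule zero[of "\<lambda>i p. if i = k then e p else 1" k])
      (auto simp: e_ind that \<epsilon>_eq intro!: if_borel if_integrable e e_int)
  show "(\<integral>w. h w * ((\<epsilon> k w)\<^sup>2 - \<sigma>\<^sup>2) \<partial>M) = 0" if "integrable M (\<lambda>w. h w * ((\<epsilon> k w)\<^sup>2 - \<sigma>\<^sup>2))"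
    by (rule zero[of "\<lambda>i p. if i = k then (e p)\<^sup>2 - \<sigma>\<^sup>2 else 1" k])
      (auto simp: e2_ind that \<epsilon>_eq intro!: if_borel if_integrable e e2_int borel_measurable_diff borel_measurable_power)
  show "(\<integral>w. h w * (\<epsilon> k w * \<epsilon> l w) \<partial>M) = 0"
    if "k \<noteq> l" "integrable M (\<lambda>w. h w * (\<epsilon> k w * \<epsilon> l w))"
  proof (rule zero[of "\<lambda>i p. if i = k \<or> i = l then e p else 1" k])
    fix w assume w: "w \<in> space M"
    have "(\<Prod>i\<in>UNIV. if i = k \<or> i = l then e (X i w, Y i w) else 1) = (\<Prod>i\<in>{k, l}. e (X i w, Y i w))"
      by (rule prod.mono_neutral_cong_right) auto
    then show "\<epsilon> k w * \<epsilon> l w = (\<Prod>i\<in>UNIV. if i = k \<or> i = l then e (X i w, Y i w) else 1)"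
      using that(1) w by (simp add: \<epsilon> e_def)
  qed (auto simp: e_ind that intro!: if_borel if_integrable e e_int)
qed

end

section \<open>Measurability in the design\<close>

context rkhs
begin

lemma Cauchy_Schwarz_ip:
  assumes f: "f \<in> H" and g: "g \<in> H"
  shows "(ip f g)\<^sup>2 \<le> ip f f * ip g g"
proof (cases "ip g g = 0")
  case True
  then have "g = (\<lambda>x. 0)" using ip_definite g by blast
  then have "ip f g = 0" using ip_commute[OF f g] ip_zero_left[OF f] by simp
  then show ?thesis using True by simp
next
  case False
  then have pos: "ip g g > 0" using ip_nonneg[OF g] by simp
  define t where "t = ip f g / ip g g"
  have tg: "(\<lambda>x. t * g x) \<in> H" using g by (rule scale_mem)
  let ?h = "\<lambda>x. f x - t * g x"
  have h: "?h \<in> H" using f tg by (rule diff_mem)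
  have "0 \<le> ip ?h ?h" using h by (rule ip_nonneg)
  also have "ip ?h ?h = ip f ?h - t * ip g ?h"
    by (simp add: ip_diff_left[OF f tg h] ip_scale_left[OF g h])
  also have "ip f ?h = ip f f - t * ip g f"
    using ip_commute[OF f h] by (simp add: ip_diff_left[OF f tg f] ip_scale_left[OF g f])
  also have "ip g ?h = ip f g - t * ip g g"
    using ip_commute[OF g h] by (simp add: ip_diff_left[OF f tg g] ip_scale_left[OF g g])
  also have "ip g f = ip f g" by (rule ip_commute[OF g f])
  finally show ?thesis
    using pos by (simp add: t_def field_simps power2_eq_square)
qed

end

text \<open>
  By the reproducing property and the Cauchy--Schwarz inequality, \<open>(f y - f x)\<^sup>2\<close> is at most
  \<open>ip f f * (K y y - 2 * K x y + K x x)\<close>, and the last factor tends to \<open>0\<close> as \<open>y\<close> tends to \<open>x\<close>.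
\<close>

lemma rkhs_continuous_on:
  fixes K :: "real^'d \<Rightarrow> real^'d \<Rightarrow> real"
  assumes rkhs: "rkhs S K H ip" and cont: "continuous_on (S \<times> S) (\<lambda>(x, y). K x y)" and f: "f \<in> H"
  shows "continuous_on S f"
  unfolding continuous_on_def
proof
  interpret rkhs S K H ip by fact
  fix x assume x: "x \<in> S"
  have contK: "continuous_on S (\<lambda>y. K (p y) (q y))"
    if "continuous_on S p" "continuous_on S q" "\<And>y. y \<in> S \<Longrightarrow> p y \<in> S \<and> q y \<in> S" for p q
  proof -
    have "continuous_on S ((\<lambda>(x, y). K x y) \<circ> (\<lambda>y. (p y, q y)))"
      using that by (intro continuous_on_compose continuous_on_Pair continuous_on_subset[OF cont]) auto
    then show ?thesis by (simp add: o_def)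
  qed
  define V where "V y = ip f f * (K y y - 2 * K x y + K x x)" for y
  have "continuous_on S V"
    unfolding V_def using x by (intro continuous_intros contK) auto
  then have "(V \<longlongrightarrow> V x) (at x within S)" using x by (simp add: continuous_on_def)
  then have V0: "((\<lambda>y. sqrt (V y)) \<longlongrightarrow> 0) (at x within S)"
    using tendsto_real_sqrt[of V "V x"] by (simp add: V_def[of x])
  have bound: "\<bar>f y - f x\<bar> \<le> sqrt (V y)" if y: "y \<in> S" for y
  proof -
    let ?k = "\<lambda>y. kernel_section S K y"
    let ?h = "\<lambda>z. ?k y z - ?k x z"
    have k: "?k x \<in> H" "?k y \<in> H" using x y section_mem by auto
    have h: "?h \<in> H" using k by (simp add: diff_mem)
    have "ip f ?h = f y - f x"
      using ip_commute[OF f h] ip_diff_left[OF k(2,1) f] ip_commute[OF k(1) f] ip_commute[OF k(2) f]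
        reproducing[OF f x] reproducing[OF f y] by simp
    moreover have "ip ?h ?h = K y y - 2 * K x y + K x x"
    proof -
      have "ip ?h ?h = ip (?k y) ?h - ip (?k x) ?h" by (rule ip_diff_left[OF k(2,1) h])
      also have "ip (?k y) ?h = ?h y" using ip_commute[OF k(2) h] reproducing[OF h y] by simp
      also have "ip (?k x) ?h = ?h x" using ip_commute[OF k(1) h] reproducing[OF h x] by simp
      also have "?k y x = ?k x y" using reproducing[OF k(1) y] reproducing[OF k(2) x] ip_commute[OF k] by simp
      finally show ?thesis using x y reproducing[OF k(1) y] reproducing[OF k(2) x] ip_commute[OF k]
        by (simp add: kernel_section_def)
    qed
    ultimately have "(f y - f x)\<^sup>2 \<le> V y"
      using Cauchy_Schwarz_ip[OF f h] by (simp add: V_def)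
    then show ?thesis using real_le_rsqrt[of "\<bar>f y - f x\<bar>"] by simp
  qed
  have "((\<lambda>y. f y - f x) \<longlongrightarrow> 0) (at x within S)"
    using V0 by (rule Lim_null_comparison[rotated]) (auto simp: eventually_at_filter bound)
  then show "(f \<longlongrightarrow> f x) (at x within S)"
    using Lim_null by blast
qed

lemma det_measurable:
  fixes A :: "'w \<Rightarrow> real^'k^'k"
  assumes "\<And>i j. (\<lambda>w. A w $ i $ j) \<in> borel_measurable N"
  shows "(\<lambda>w. det (A w)) \<in> borel_measurable N"
  unfolding det_def by (intro borel_measurable_sum borel_measurable_times borel_measurable_prod borel_measurable_const assms)

lemma kernel_design_measurable:
  fixes X Z :: "'w \<Rightarrow> real^'d"
  assumes cont: "continuous_on (S \<times> S) (\<lambda>(x, y). K x y)"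
    and X: "X \<in> measurable N (restrict_space borel S)" and Z: "Z \<in> measurable N (restrict_space borel S)"
  shows "(\<lambda>w. K (X w) (Z w)) \<in> borel_measurable N"
proof -
  have borel: "X \<in> borel_measurable N" "Z \<in> borel_measurable N"
    and S: "X \<in> space N \<rightarrow> S" "Z \<in> space N \<rightarrow> S"
    using X Z by (auto simp: measurable_restrict_space2_iff)
  have "(\<lambda>w. (X w, Z w)) \<in> borel_measurable N"
    using borel by simp
  then have "(\<lambda>w. (X w, Z w)) \<in> measurable N (restrict_space borel (S \<times> S))"
    using S by (intro measurable_restrict_space2) auto
  from measurable_compose[OF this borel_measurable_continuous_on_restrict[OF cont]]
  show ?thesis by simp
qed

lemma residual_matrix_measurable:
  fixes X :: "'n::finite \<Rightarrow> 'w \<Rightarrow> real^'d"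
  assumes cont: "continuous_on (S \<times> S) (\<lambda>(x, y). K x y)"
    and X: "\<And>i. X i \<in> measurable N (restrict_space borel S)"
  shows "(\<lambda>w. residual_matrix c K (\<lambda>i. X i w) i k) \<in> borel_measurable N"
proof -
  have comp: "(\<lambda>w. X i w $ j) \<in> borel_measurable N" for i j
  proof -
    have "(\<lambda>v::real^'d. v $ j) \<in> borel_measurable borel"
      by (intro borel_measurable_continuous_onI continuous_intros)
    moreover have "X i \<in> borel_measurable N"
      using X[of i] by (simp add: measurable_restrict_space2_iff)
    ultimately show ?thesis by (rule measurable_compose[rotated])
  qed
  have entry: "(\<lambda>w. saddle_matrix c K (\<lambda>i. X i w) $ p $ q) \<in> borel_measurable N" for p q
    by (cases p; cases q) (auto simp: saddle_matrix_def comp intro!: borel_measurable_add borel_measurable_divide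
        kernel_design_measurable[OF cont X X])
  have "(\<lambda>w. (\<chi> p q. if q = Inl i then (if p = Inl k then 1 else 0)
      else saddle_matrix c K (\<lambda>i. X i w) $ p $ q) $ p $ q) \<in> borel_measurable N" for p q
    by (cases "q = Inl i") (simp_all add: entry)
  then show ?thesis
    unfolding residual_matrix_def
    by (intro borel_measurable_divide det_measurable entry)
qed

section \<open>Bias and variance of a linear smoother\<close>

context random_design
begin

lemma AE_design: "(AE x in \<rho>. P x) \<Longrightarrow> AE w in M. \<forall>i. P (X i w)"
proof -
  assume P: "AE x in \<rho>. P x"
  have "AE w in M. P (X i w)" for i
    using AE_distrD[OF X_measurable[of i], of P] P unfolding X_distr .
  then show ?thesis by (simp add: AE_all_countable)
qed

lemma prob_space_on_design: "prob_space_on \<rho> S"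
proof -
  have "prob_space \<rho>"
    using prob_space_distr[OF X_measurable] X_distr[of undefined] by metis
  then show ?thesis
    using sets_\<rho> by (simp add: prob_space_on_def prob_space_on_axioms_def)
qed

lemma nn_integral_design:
  assumes "g \<in> borel_measurable \<rho>"
  shows "(\<integral>\<^sup>+ w. g (X i w) \<partial>M) = (\<integral>\<^sup>+ x. g x \<partial>\<rho>)"
proof -
  have "g \<in> borel_measurable (restrict_space borel S)"
    using assms measurable_cong_sets[OF sets_\<rho> refl] by blast
  then have "(\<integral>\<^sup>+ x. g x \<partial>distr M (restrict_space borel S) (X i)) = (\<integral>\<^sup>+ w. g (X i w) \<partial>M)"
    by (subst nn_integral_distr[OF X_measurable]) simp_all
  then show ?thesis by (simp add: X_distr)
qed

text \<open>
  The bias-variance decomposition for one row \<open>A\<close> of the smoother. As \<open>A\<close> is bounded and \<open>b\<close> square integrable, every term of the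
  expanded square is integrable, so that the terms may be integrated separately.
\<close>

lemma nn_integral_smoother_square:
  assumes b: "b \<in> borel_measurable design_algebra" "integrable M (\<lambda>w. (b w)\<^sup>2)"
    and A: "\<And>k. A k \<in> borel_measurable design_algebra" "\<And>k. AE w in M. \<bar>A k w\<bar> \<le> 1"
  shows "(\<integral>\<^sup>+ w. ennreal (((\<Sum>k\<in>UNIV. A k w * \<epsilon> k w) - b w)\<^sup>2) \<partial>M)
    = (\<integral>\<^sup>+ w. ennreal ((b w)\<^sup>2) \<partial>M) + ennreal (\<sigma>\<^sup>2) * (\<Sum>k\<in>UNIV. \<integral>\<^sup>+ w. ennreal ((A k w)\<^sup>2) \<partial>M)"
proof -
  note bM [measurable] = measurable_from_subalg[OF subalgebra_design b(1)]
  note AM [measurable] = measurable_from_subalg[OF subalgebra_design A(1)]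
  have A1: "integrable M (\<lambda>w. A k w * f w)" if "integrable M f" for k and f :: "'w \<Rightarrow> real"
  proof (rule Bochner_Integration.integrable_bound[OF that])
    show "AE w in M. norm (A k w * f w) \<le> norm (f w)"
      using A(2)[of k] by eventually_elim (simp add: abs_mult mult_left_le_one_le)
  qed (use that in measurable)
  have L2: "(\<lambda>w. \<epsilon> k w) \<in> L2_functions M" "b \<in> L2_functions M" for k
    using noise_square_integrable b(2) by (auto simp: L2_functions_def)
  have ee: "integrable M (\<lambda>w. \<epsilon> k w * \<epsilon> l w)" and be: "integrable M (\<lambda>w. b w * \<epsilon> k w)" for k l
    by (intro L2_functions_mult_integrable L2)+
  have A2: "integrable M (\<lambda>w. (A k w)\<^sup>2)" for k
    using A1[OF A1[of "\<lambda>_. 1"], of k k] by (simp add: power2_eq_square)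
  have AAee: "integrable M (\<lambda>w. A k w * A l w * (\<epsilon> k w * \<epsilon> l w))" for k l
    using A1[OF A1[OF ee[of k l], of l], of k] by (simp add: mult_ac)
  have bAe: "integrable M (\<lambda>w. b w * A k w * \<epsilon> k w)" for k
    using A1[OF be[of k], of k] by (simp add: mult_ac)
  have cross: "(\<integral>w. b w * A k w * \<epsilon> k w \<partial>M) = 0" for k
    using noise_orthogonal_to_design(1)[of "\<lambda>w. b w * A k w" k] b(1) A(1) bAe by auto
  have pair: "(\<integral>w. A k w * A l w * (\<epsilon> k w * \<epsilon> l w) \<partial>M) = (if k = l then \<sigma>\<^sup>2 * (\<integral>w. (A k w)\<^sup>2 \<partial>M) else 0)" for k l
  proof (cases "k = l")
    case False
    then show ?thesis
      using noise_orthogonal_to_design(2)[of "\<lambda>w. A k w * A l w" k l] A(1) AAee by auto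
  next
    case True
    have int: "integrable M (\<lambda>w. (A k w)\<^sup>2 * ((\<epsilon> k w)\<^sup>2 - \<sigma>\<^sup>2))"
    proof -
      have "integrable M (\<lambda>w. A k w * A k w * (\<epsilon> k w * \<epsilon> k w) - \<sigma>\<^sup>2 * (A k w)\<^sup>2)"
        using AAee A2 by auto
      then show ?thesis by (simp add: algebra_simps power2_eq_square)
    qed
    have "0 = (\<integral>w. (A k w)\<^sup>2 * ((\<epsilon> k w)\<^sup>2 - \<sigma>\<^sup>2) \<partial>M)"
      using noise_orthogonal_to_design(3)[OF _ int] A(1)[of k] by simp
    also have "\<dots> = (\<integral>w. A k w * A k w * (\<epsilon> k w * \<epsilon> k w) - \<sigma>\<^sup>2 * (A k w)\<^sup>2 \<partial>M)"
      by (simp add: algebra_simps power2_eq_square)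
    also have "\<dots> = (\<integral>w. A k w * A k w * (\<epsilon> k w * \<epsilon> k w) \<partial>M) - \<sigma>\<^sup>2 * (\<integral>w. (A k w)\<^sup>2 \<partial>M)"
      using AAee A2 by simp
    finally show ?thesis using True by simp
  qed
  have expand: "((\<Sum>k\<in>UNIV. A k w * \<epsilon> k w) - b w)\<^sup>2 = (b w)\<^sup>2 - 2 * (\<Sum>k\<in>UNIV. b w * A k w * \<epsilon> k w)
      + (\<Sum>k\<in>UNIV. \<Sum>l\<in>UNIV. A k w * A l w * (\<epsilon> k w * \<epsilon> l w))" for w
  proof -
    have "(\<Sum>k\<in>UNIV. A k w * \<epsilon> k w) * (\<Sum>l\<in>UNIV. A l w * \<epsilon> l w)
        = (\<Sum>k\<in>UNIV. \<Sum>l\<in>UNIV. A k w * A l w * (\<epsilon> k w * \<epsilon> l w))"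
      by (simp add: sum_product mult_ac)
    moreover have "(s - t)\<^sup>2 = t\<^sup>2 - 2 * (t * s) + s * s" for s t :: real
      by (simp add: power2_eq_square algebra_simps)
    ultimately show ?thesis
      by (simp add: sum_distrib_left mult.assoc)
  qed
  have int: "integrable M (\<lambda>w. ((\<Sum>k\<in>UNIV. A k w * \<epsilon> k w) - b w)\<^sup>2)"
    unfolding expand using b(2) bAe AAee by auto
  have "(\<integral>w. ((\<Sum>k\<in>UNIV. A k w * \<epsilon> k w) - b w)\<^sup>2 \<partial>M)
      = (\<integral>w. (b w)\<^sup>2 \<partial>M) + \<sigma>\<^sup>2 * (\<Sum>k\<in>UNIV. \<integral>w. (A k w)\<^sup>2 \<partial>M)"
    unfolding expand using b(2) bAe AAee
    by (simp add: cross pair sum_distrib_left)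
  then have "(\<integral>\<^sup>+ w. ennreal (((\<Sum>k\<in>UNIV. A k w * \<epsilon> k w) - b w)\<^sup>2) \<partial>M)
      = ennreal ((\<integral>w. (b w)\<^sup>2 \<partial>M) + \<sigma>\<^sup>2 * (\<Sum>k\<in>UNIV. \<integral>w. (A k w)\<^sup>2 \<partial>M))"
    using nn_integral_eq_integral[OF int] by simp
  also have "\<dots> = ennreal (\<integral>w. (b w)\<^sup>2 \<partial>M) + ennreal (\<sigma>\<^sup>2) * (\<Sum>k\<in>UNIV. ennreal (\<integral>w. (A k w)\<^sup>2 \<partial>M))"
    by (simp add: sum_nonneg ennreal_mult)
  also have "ennreal (\<integral>w. (b w)\<^sup>2 \<partial>M) = (\<integral>\<^sup>+ w. ennreal ((b w)\<^sup>2) \<partial>M)"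
    using nn_integral_eq_integral[OF b(2)] by simp
  also have "(\<Sum>k\<in>UNIV. ennreal (\<integral>w. (A k w)\<^sup>2 \<partial>M)) = (\<Sum>k\<in>UNIV. \<integral>\<^sup>+ w. ennreal ((A k w)\<^sup>2) \<partial>M)"
    by (simp add: nn_integral_eq_integral[OF A2])
  finally show ?thesis .
qed

section \<open>The expected trace of the smoother\<close>

lemma AE_saddle_matrix:
  assumes rkhs: "rkhs S K H ip" and c: "c > 0"
  shows "AE w in M. det (saddle_matrix c K (\<lambda>i. X i w)) \<noteq> 0"
  using full_rank AE_space
proof eventually_elim
  case (elim w)
  interpret rkhs S K H ip by fact
  show ?case
    using elim X_in_S by (intro det_saddle_matrix_nonzero c gram_matrix_psd) auto
qed

text \<open>
  The bound of \<open>effective_dimension_limit\<close> holds for almost every design and is integrated by Fatou's lemma.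
  The factor \<open>n\<close> from the sum over the design points cancels the \<open>n\<close> in \<open>c = n * l\<close>.
\<close>

lemma expected_trace_le:
  assumes rkhs: "rkhs S K H ip" and cont: "continuous_on (S \<times> S) (\<lambda>(x, y). K x y)"
    and eigen: "eigen_decomposition \<rho> K \<mu> \<phi>" and l: "l > 0"
  shows "(\<integral>\<^sup>+ w. (\<Sum>k\<in>UNIV. ennreal (1 - residual_matrix (real CARD('n) * l) K (\<lambda>i. X i w) k k)) \<partial>M)
    \<le> ennreal (real CARD('d)) + (\<Sum>j. ennreal (min l (\<mu> j))) / ennreal l"
proof (cases "\<exists>N. \<mu> N \<le> l")
  case False
  then have "l \<le> \<mu> j" for j by (meson linear)
  then have "min l (\<mu> j) = l" for j by (simp add: min_absorb1)
  moreover have "(\<Sum>j::nat. ennreal l) = \<top>"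
  proof (rule ccontr)
    assume "(\<Sum>j::nat. ennreal l) \<noteq> \<top>"
    then have "summable (\<lambda>j::nat. l)"
      using l by (intro summable_suminf_not_top) auto
    from summable_LIMSEQ_zero[OF this] show False using l by (simp add: LIMSEQ_const_iff)
  qed
  ultimately have "(\<Sum>j. ennreal (min l (\<mu> j))) = \<top>" by simp
  then show ?thesis using l by (simp add: ennreal_top_divide)
next
  case True
  \<comment> \<open>Precisely the eigenvalues with index below \<open>N\<close> exceed \<open>l\<close>, as \<open>\<mu>\<close> is non-increasing.\<close>
  define N where "N = (LEAST N. \<mu> N \<le> l)"
  have \<mu>: "\<mu> j \<ge> 0" "decseq \<mu>" and \<phi>: "\<phi> j \<in> L2_functions \<rho>" "L2_inner \<rho> (\<phi> j) (\<phi> j) = 1" for j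
    using eigen by (auto simp: eigen_decomposition_def L2_orthonormal_basis_def)
  have L2: "L2_operator \<rho> K" using eigen by (simp add: eigen_decomposition_def)
  have N1: "\<mu> j \<le> l" if "j \<ge> N" for j
    using LeastI_ex[OF True] decseqD[OF \<mu>(2) that] by (simp add: N_def)
  have N2: "\<mu> j > l" if "j < N" for j
    using not_less_Least[of j "\<lambda>N. \<mu> N \<le> l"] that by (simp add: N_def not_le)
  interpret \<rho>: prob_space_on \<rho> S by (rule prob_space_on_design)
  let ?c = "real CARD('n) * l"
  have c: "?c > 0" using l by simp
  define p where "p w r j i = \<rho>.cell_average r (\<phi> j) (X i w)" for w r j i
  define C where "C r w = ennreal (1 / ?c) * (\<Sum>j. ennreal (\<mu> (j + N) * (\<Sum>i\<in>UNIV. (p w r (j + N) i)\<^sup>2)))" for r w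
  have avg_meas: "\<rho>.cell_average r (\<phi> j) \<in> borel_measurable \<rho>" for r j
    using \<phi>(1)[of j] by (intro \<rho>.cell_average_measurable) (simp add: L2_functions_def)
  have p_meas [measurable]: "(\<lambda>w. p w r j i) \<in> borel_measurable M" for r j i
  proof -
    have "\<rho>.cell_average r (\<phi> j) \<in> borel_measurable (restrict_space borel S)"
      using avg_meas measurable_cong_sets[OF sets_\<rho> refl] by blast
    then show ?thesis unfolding p_def by (rule measurable_compose[OF X_measurable])
  qed
  have pointwise: "AE w in M. (\<Sum>k\<in>UNIV. ennreal (1 - residual_matrix ?c K (\<lambda>i. X i w) k k))
      \<le> ennreal (real (CARD('d) + N)) + liminf (\<lambda>r. C r w)"
    using AE_saddle_matrix[OF rkhs c] AE_design[OF \<rho>.AE_cell_mass_pos] AE_space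
  proof eventually_elim
    case (elim w)
    let ?x = "\<lambda>i. X i w"
    let ?B = "residual_matrix ?c K ?x"
    have x: "?x i \<in> S" for i using elim X_in_S by simp
    define Q where "Q k \<alpha> a = (\<Sum>i\<in>UNIV. (axis k 1 $ i - ?x i \<bullet> \<alpha> - (\<Sum>l\<in>UNIV. a l * K (?x i) (?x l)))\<^sup>2)
      + ?c * (\<Sum>l\<in>UNIV. \<Sum>m\<in>UNIV. a l * a m * K (?x l) (?x m))" for k \<alpha> a
    have "\<exists>\<alpha> a. ?B k k = Q k \<alpha> a" for k
      unfolding Q_def by (rule residual_matrix_diagonal[OF rkhs x c elim(1), of k]) blast
    then obtain \<alpha> a where B: "\<And>k. ?B k k = Q k (\<alpha> k) (a k)"
      by metis
    have B01: "?B k k \<ge> 0" "1 - ?B k k \<ge> 0" for k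
    proof -
      have "?B k k \<ge> 0 \<and> (\<Sum>i\<in>UNIV. (axis k 1 $ i - ?B i k)\<^sup>2) \<le> 1 - ?B k k"
        by (rule residual_matrix_diagonal[OF rkhs x c elim(1), of k]) blast
      moreover have "(\<Sum>i\<in>UNIV. (axis k 1 $ i - ?B i k)\<^sup>2) \<ge> 0" by (simp add: sum_nonneg)
      ultimately show "?B k k \<ge> 0" "1 - ?B k k \<ge> 0" by linarith+
    qed
    have "ennreal (real CARD('n)) \<le> ennreal (real (CARD('d) + N)) + liminf (\<lambda>r. C r w)
      + ennreal (\<Sum>k\<in>UNIV. ?B k k)"
      unfolding B Q_def C_def
    proof (rule effective_dimension_limit[OF \<mu>(1) c])
      show "(\<lambda>L. \<Sum>j<L. \<mu> j * p w r j i * p w r j k) \<longlonglongrightarrow> \<rho>.kernel_cell_average K r (?x i) (?x k)" for r i k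
        unfolding p_def by (rule \<rho>.kernel_cell_average_series[OF eigen])
      show "(\<lambda>r. \<rho>.kernel_cell_average K r (?x i) (?x k)) \<longlonglongrightarrow> K (?x i) (?x k)" for i k
        using elim by (intro \<rho>.kernel_cell_average_tendsto[OF L2 cont] x) auto
    qed
    then have "ennreal (real CARD('n)) - ennreal (\<Sum>k\<in>UNIV. ?B k k) \<le> ennreal (real (CARD('d) + N)) + liminf (\<lambda>r. C r w)"
      by (subst ennreal_minus_le_iff) (auto simp: add_ac)
    moreover have "(\<Sum>k\<in>UNIV. ennreal (1 - ?B k k)) = ennreal (real CARD('n)) - ennreal (\<Sum>k\<in>UNIV. ?B k k)"
    proof -
      have "(\<Sum>k\<in>UNIV. ennreal (1 - ?B k k)) = ennreal (\<Sum>k\<in>UNIV. 1 - ?B k k)"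
        by (rule sum_ennreal) (rule B01(2))
      also have "(\<Sum>k\<in>UNIV. 1 - ?B k k) = real CARD('n) - (\<Sum>k\<in>UNIV. ?B k k)"
        by (simp add: sum_subtractf)
      finally show ?thesis
        by (simp add: ennreal_minus sum_nonneg B01(1))
    qed
    ultimately show ?case by simp
  qed
  have C_meas: "C r \<in> borel_measurable M" for r
    unfolding C_def by measurable
  have C_int: "(\<integral>\<^sup>+ w. C r w \<partial>M) \<le> ennreal (1 / l) * (\<Sum>j. ennreal (\<mu> (j + N)))" for r
  proof -
    have "(\<integral>\<^sup>+ w. C r w \<partial>M) = ennreal (1 / ?c) * (\<Sum>j. \<integral>\<^sup>+ w. ennreal (\<mu> (j + N) * (\<Sum>i\<in>UNIV. (p w r (j + N) i)\<^sup>2)) \<partial>M)"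
      unfolding C_def by (simp add: nn_integral_cmult nn_integral_suminf)
    also have "\<dots> \<le> ennreal (1 / ?c) * (\<Sum>j. ennreal (real CARD('n)) * ennreal (\<mu> (j + N)))"
    proof (intro mult_left_mono suminf_le summableI)
      fix j
      have "(\<integral>\<^sup>+ w. ennreal ((p w r (j + N) i)\<^sup>2) \<partial>M) \<le> 1" for i
      proof -
        have "(\<integral>\<^sup>+ w. ennreal ((p w r (j + N) i)\<^sup>2) \<partial>M) = (\<integral>\<^sup>+ x. ennreal ((\<rho>.cell_average r (\<phi> (j + N)) x)\<^sup>2) \<partial>\<rho>)"
          unfolding p_def using avg_meas[of r "j + N"]
          by (intro nn_integral_design[where g="\<lambda>x. ennreal ((\<rho>.cell_average r (\<phi> (j + N)) x)\<^sup>2)"]) measurable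
        also have "\<dots> \<le> 1"
          using \<rho>.cell_average_contraction[OF \<phi>(1)] by (simp add: \<phi>(2))
        finally show ?thesis .
      qed
      then have "(\<Sum>i\<in>(UNIV::'n set). \<integral>\<^sup>+ w. ennreal ((p w r (j + N) i)\<^sup>2) \<partial>M) \<le> (\<Sum>i\<in>(UNIV::'n set). 1)"
        by (intro sum_mono)
      then have "ennreal (\<mu> (j + N)) * (\<Sum>i\<in>(UNIV::'n set). \<integral>\<^sup>+ w. ennreal ((p w r (j + N) i)\<^sup>2) \<partial>M)
          \<le> ennreal (\<mu> (j + N)) * ennreal (real CARD('n))"
        by (intro mult_left_mono) (simp_all add: ennreal_of_nat_eq_real_of_nat)
      moreover have "(\<integral>\<^sup>+ w. ennreal (\<mu> (j + N) * (\<Sum>i\<in>UNIV. (p w r (j + N) i)\<^sup>2)) \<partial>M)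
          = ennreal (\<mu> (j + N)) * (\<Sum>i\<in>UNIV. \<integral>\<^sup>+ w. ennreal ((p w r (j + N) i)\<^sup>2) \<partial>M)"
      proof -
        have "ennreal (\<mu> (j + N) * (\<Sum>i\<in>UNIV. (p w r (j + N) i)\<^sup>2))
            = ennreal (\<mu> (j + N)) * (\<Sum>i\<in>UNIV. ennreal ((p w r (j + N) i)\<^sup>2))" for w
          by (simp add: ennreal_mult \<mu>(1) sum_nonneg)
        then show ?thesis by (simp add: nn_integral_cmult nn_integral_sum del: sum_ennreal)
      qed
      ultimately show "(\<integral>\<^sup>+ w. ennreal (\<mu> (j + N) * (\<Sum>i\<in>UNIV. (p w r (j + N) i)\<^sup>2)) \<partial>M)
          \<le> ennreal (real CARD('n)) * ennreal (\<mu> (j + N))"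
        by (simp add: mult.commute)
    qed auto
    also have "\<dots> = (ennreal (1 / ?c) * ennreal (real CARD('n))) * (\<Sum>j. ennreal (\<mu> (j + N)))"
      by (simp add: ennreal_suminf_cmult mult.assoc)
    also have "ennreal (1 / ?c) * ennreal (real CARD('n)) = ennreal (1 / l)"
      using l by (simp flip: ennreal_mult)
    finally show ?thesis .
  qed
  have "(\<integral>\<^sup>+ w. (\<Sum>k\<in>UNIV. ennreal (1 - residual_matrix ?c K (\<lambda>i. X i w) k k)) \<partial>M)
      \<le> (\<integral>\<^sup>+ w. ennreal (real (CARD('d) + N)) + liminf (\<lambda>r. C r w) \<partial>M)"
    by (rule nn_integral_mono_AE[OF pointwise])
  also have "\<dots> = ennreal (real (CARD('d) + N)) + (\<integral>\<^sup>+ w. liminf (\<lambda>r. C r w) \<partial>M)"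
    using C_meas by (subst nn_integral_add) (auto simp: emeasure_space_1)
  also have "\<dots> \<le> ennreal (real (CARD('d) + N)) + liminf (\<lambda>r. \<integral>\<^sup>+ w. C r w \<partial>M)"
    by (intro add_left_mono nn_integral_liminf C_meas)
  also have "\<dots> \<le> ennreal (real (CARD('d) + N)) + liminf (\<lambda>r. ennreal (1 / l) * (\<Sum>j. ennreal (\<mu> (j + N))))"
    by (intro add_left_mono Liminf_mono always_eventually allI C_int)
  also have "\<dots> = ennreal (real CARD('d)) + (ennreal (real N) + (\<Sum>j. ennreal (\<mu> (j + N))) / ennreal l)"
    using l by (simp add: Liminf_const divide_ennreal_def inverse_ennreal mult.commute add.assoc inverse_eq_divide)
  also have "ennreal (real N) + (\<Sum>j. ennreal (\<mu> (j + N))) / ennreal l = (\<Sum>j. ennreal (min l (\<mu> j))) / ennreal l"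
  proof -
    have "(\<Sum>j. ennreal (min l (\<mu> j))) = (\<Sum>j. ennreal (min l (\<mu> (j + N)))) + (\<Sum>j<N. ennreal (min l (\<mu> j)))"
      by (rule suminf_offset) auto
    also have "(\<Sum>j. ennreal (min l (\<mu> (j + N)))) = (\<Sum>j. ennreal (\<mu> (j + N)))"
      by (simp add: min_absorb2 N1)
    also have "(\<Sum>j<N. ennreal (min l (\<mu> j))) = (\<Sum>j<N. ennreal l)"
      by (intro sum.cong) (simp_all add: min_absorb1 less_imp_le N2)
    also have "\<dots> = ennreal (real N) * ennreal l"
      by (simp add: ennreal_of_nat_eq_real_of_nat)
    finally have "(\<Sum>j. ennreal (min l (\<mu> j))) / ennreal l
        = (\<Sum>j. ennreal (\<mu> (j + N))) / ennreal l + ennreal (real N) * ennreal l / ennreal l"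
      by (simp add: add_divide_distrib_ennreal)
    also have "ennreal (real N) * ennreal l / ennreal l = ennreal (real N)"
      using l by (simp add: divide_ennreal flip: ennreal_mult)
    finally show ?thesis by (simp add: add.commute)
  qed
  finally show ?thesis .
qed

end

section \<open>The risk bound\<close>

lemma kernel_complexity_square:
  "(kernel_complexity n \<mu> l)\<^sup>2 = ennreal (1 / real n) * (\<Sum>j. ennreal (min l (\<mu> j)))"
proof -
  have "(ennreal_sqrt t)\<^sup>2 = t" for t
  proof (cases t)
    case (real r)
    then show ?thesis by (simp add: ennreal_sqrt_def ennreal_power)
  next
    case top
    then show ?thesis by (simp add: ennreal_sqrt_def power2_eq_square ennreal_top_mult)
  qed
  then show ?thesis by (simp add: kernel_complexity_def)
qed

context random_design
begin

text \<open>
  The estimator is only known to be some minimizer, with no measurability in the sample. Its fitted values are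
  nevertheless determined by the data, and they agree almost surely with a measurable function of them.
\<close>

lemma AE_fitted_error:
  assumes rkhs: "rkhs S K H ip" and l: "l > 0"
    and estimator: "AE w in M.
          is_arg_min (penalized_loss ip l (\<lambda>i. X i w) (\<lambda>i. Y i w)) (\<lambda>(\<alpha>, g). g \<in> H) (alphahat w, ghat w)"
  shows "AE w in M. \<forall>i. X i w \<bullet> alphahat w + ghat w (X i w) - fstar (X i w)
    = (\<Sum>k\<in>UNIV. (axis k 1 $ i - residual_matrix (real CARD('n) * l) K (\<lambda>i. X i w) i k) * \<epsilon> k w)
      - residual (real CARD('n) * l) K (\<lambda>i. X i w) (\<lambda>i. fstar (X i w)) i"
proof -
  have c: "real CARD('n) * l > 0" using l by simp
  show ?thesis
    using AE_saddle_matrix[OF rkhs c] estimator AE_space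
  proof eventually_elim
    case (elim w)
    have "X i w \<bullet> alphahat w + ghat w (X i w)
        = Y i w - residual (real CARD('n) * l) K (\<lambda>i. X i w) (\<lambda>i. Y i w) i" for i
      using elim X_in_S by (intro fitted_values_unique[OF rkhs _ l]) auto
    moreover have "(\<lambda>i. Y i w) = (\<lambda>i. fstar (X i w) + \<epsilon> i w)"
      using regression elim by auto
    moreover have "(\<Sum>k\<in>UNIV. axis k 1 $ i * \<epsilon> k w) = \<epsilon> i w" for i
      by (simp add: axis_def if_distrib if_distribR cong: if_cong)
    ultimately show ?case
      by (simp add: fun_eq_iff residual_add left_diff_distrib sum_subtractf residual_def[where y="\<lambda>i. \<epsilon> i w"])
  qed
qed

lemma AE_smoother_bounds:
  assumes rkhs: "rkhs S K H ip" and c: "c > 0"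
  shows "AE w in M. \<forall>k.
      (\<Sum>i\<in>UNIV. (axis k 1 $ i - residual_matrix c K (\<lambda>i. X i w) i k)\<^sup>2) \<le> 1 - residual_matrix c K (\<lambda>i. X i w) k k"
    and "AE w in M. \<bar>axis k 1 $ i - residual_matrix c K (\<lambda>i. X i w) i k\<bar> \<le> 1"
proof -
  have *: "AE w in M. \<forall>k. 0 \<le> residual_matrix c K (\<lambda>i. X i w) k k \<and>
      (\<Sum>i\<in>UNIV. (axis k 1 $ i - residual_matrix c K (\<lambda>i. X i w) i k)\<^sup>2) \<le> 1 - residual_matrix c K (\<lambda>i. X i w) k k"
    using AE_saddle_matrix[OF rkhs c] AE_space
  proof eventually_elim
    case (elim w)
    have x: "X i w \<in> S" for i using elim X_in_S by simp
    show ?case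
      by (intro allI, rule residual_matrix_diagonal[OF rkhs x c elim(1)]) blast
  qed
  then show "AE w in M. \<forall>k.
      (\<Sum>i\<in>UNIV. (axis k 1 $ i - residual_matrix c K (\<lambda>i. X i w) i k)\<^sup>2) \<le> 1 - residual_matrix c K (\<lambda>i. X i w) k k"
    by eventually_elim blast
  from * show "AE w in M. \<bar>axis k 1 $ i - residual_matrix c K (\<lambda>i. X i w) i k\<bar> \<le> 1"
  proof eventually_elim
    case (elim w)
    let ?A = "\<lambda>i. axis k 1 $ i - residual_matrix c K (\<lambda>i. X i w) i k"
    have "(?A i)\<^sup>2 \<le> (\<Sum>i\<in>UNIV. (?A i)\<^sup>2)"
      by (rule member_le_sum) auto
    also have "\<dots> \<le> 1" using elim[rule_format, of k] by linarith
    finally show ?case by (simp add: abs_square_le_1)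
  qed
qed

text \<open>
  The left-hand side is the squared residual of the fit to the noiseless data \<open>fstar (X i w)\<close>, so for
  each design it is at most the loss of the fixed competitor \<open>(\<alpha>, f)\<close>.
\<close>

lemma bias_le_approximation_error:
  assumes rkhs: "rkhs S K H ip" and cont: "continuous_on (S \<times> S) (\<lambda>(x, y). K x y)"
    and l: "l > 0" and f: "f \<in> H"
  shows "(\<Sum>i\<in>UNIV. \<integral>\<^sup>+ w. ennreal ((residual (real CARD('n) * l) K (\<lambda>i. X i w) (\<lambda>i. fstar (X i w)) i)\<^sup>2) \<partial>M)
    \<le> ennreal (real CARD('n)) * (risk M X (\<lambda>w x. x \<bullet> \<alpha> + f x - fstar x) + ennreal (l * (hilbert_norm ip f)\<^sup>2))"
proof -
  interpret rkhs S K H ip by fact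
  let ?c = "real CARD('n) * l"
  have c: "?c > 0" using l by simp
  let ?b = "\<lambda>i w. residual ?c K (\<lambda>i. X i w) (\<lambda>i. fstar (X i w)) i"
  let ?g = "\<lambda>i w. (X i w \<bullet> \<alpha> + f (X i w) - fstar (X i w))\<^sup>2"
  have fstar_meas [measurable]: "(\<lambda>w. fstar (X i w)) \<in> borel_measurable M" for i
    by (rule fstar_X_measurable[OF X_measurable])
  have [measurable]: "(\<lambda>w. f (X i w)) \<in> borel_measurable M" for i
    by (rule measurable_compose[OF X_measurable borel_measurable_continuous_on_restrict[OF rkhs_continuous_on[OF rkhs cont f]]])
  have [measurable]: "?b i \<in> borel_measurable M" for i
    unfolding residual_def
    by (intro borel_measurable_sum borel_measurable_times residual_matrix_measurable[OF cont X_measurable] fstar_meas)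
  have "(\<Sum>i\<in>UNIV. \<integral>\<^sup>+ w. ennreal ((?b i w)\<^sup>2) \<partial>M) = (\<integral>\<^sup>+ w. (\<Sum>i\<in>UNIV. ennreal ((?b i w)\<^sup>2)) \<partial>M)"
    by (simp add: nn_integral_sum del: sum_ennreal)
  also have "\<dots> \<le> (\<integral>\<^sup>+ w. (\<Sum>i\<in>UNIV. ennreal (?g i w)) + ennreal (?c * ip f f) \<partial>M)"
  proof (rule nn_integral_mono_AE)
    show "AE w in M. (\<Sum>i\<in>UNIV. ennreal ((?b i w)\<^sup>2)) \<le> (\<Sum>i\<in>UNIV. ennreal (?g i w)) + ennreal (?c * ip f f)"
      using AE_saddle_matrix[OF rkhs c] AE_space
    proof eventually_elim
      case (elim w)
      have "(\<Sum>i\<in>UNIV. (?b i w)\<^sup>2) \<le> (\<Sum>i\<in>UNIV. (fstar (X i w) - X i w \<bullet> \<alpha> - f (X i w))\<^sup>2) + ?c * ip f f"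
        using elim X_in_S by (intro residual_norm_le_loss[OF rkhs _ c _ f]) auto
      also have "(\<Sum>i\<in>UNIV. (fstar (X i w) - X i w \<bullet> \<alpha> - f (X i w))\<^sup>2) = (\<Sum>i\<in>UNIV. ?g i w)"
        by (intro sum.cong refl) (simp add: power2_eq_square algebra_simps)
      finally have "ennreal (\<Sum>i\<in>UNIV. (?b i w)\<^sup>2) \<le> ennreal ((\<Sum>i\<in>UNIV. ?g i w) + ?c * ip f f)"
        by (rule ennreal_leI)
      then show ?case
        using c ip_nonneg[OF f] by (simp add: sum_nonneg)
    qed
  qed
  also have "\<dots> = (\<Sum>i\<in>UNIV. \<integral>\<^sup>+ w. ennreal (?g i w) \<partial>M) + ennreal (?c * ip f f)"
    by (simp add: nn_integral_add nn_integral_sum emeasure_space_1 del: sum_ennreal)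
  also have "(\<Sum>i\<in>UNIV. \<integral>\<^sup>+ w. ennreal (?g i w) \<partial>M)
      = ennreal (real CARD('n)) * risk M X (\<lambda>w x. x \<bullet> \<alpha> + f x - fstar x)"
  proof -
    have "ennreal (real CARD('n)) * ennreal (1 / real CARD('n)) = 1"
      by (simp flip: ennreal_mult)
    then show ?thesis
      by (simp add: risk_def flip: mult.assoc)
  qed
  also have "ennreal (?c * ip f f) = ennreal (real CARD('n)) * ennreal (l * (hilbert_norm ip f)\<^sup>2)"
    using l ip_nonneg[OF f] by (simp add: hilbert_norm_square[OF f] mult.assoc flip: ennreal_mult)
  finally show ?thesis
    by (simp add: distrib_left)
qed

end

theorem theorem3:
  fixes M :: "'w measure"
    and S :: "(real^'d) set"
    and \<rho> :: "(real^'d) measure"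
    and fstar :: "real^'d \<Rightarrow> real"
    and \<sigma> lam :: real
    and X :: "'n::finite \<Rightarrow> 'w \<Rightarrow> real^'d"
    and Y \<epsilon> :: "'n \<Rightarrow> 'w \<Rightarrow> real"
    and K :: "real^'d \<Rightarrow> real^'d \<Rightarrow> real"
    and H :: "(real^'d \<Rightarrow> real) set"
    and ip :: "(real^'d \<Rightarrow> real) \<Rightarrow> (real^'d \<Rightarrow> real) \<Rightarrow> real"
    and \<mu> :: "nat \<Rightarrow> real"
    and \<phi> :: "nat \<Rightarrow> real^'d \<Rightarrow> real"
    and alphahat :: "'w \<Rightarrow> real^'d"
    and ghat :: "'w \<Rightarrow> real^'d \<Rightarrow> real"
  assumes model: "random_design M S \<rho> fstar \<sigma> X Y \<epsilon>"
    and symmetric: "symmetric_kernel S K"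
    and psd: "psd_kernel S K"
    and continuous: "continuous_on (S \<times> S) (\<lambda>(x, y). K x y)"
    and rkhs: "rkhs S K H ip"
    and eigen: "eigen_decomposition \<rho> K \<mu> \<phi>"
    and lam: "lam > 0"
    and estimator: "AE w in M.
          is_arg_min (penalized_loss ip lam (\<lambda>i. X i w) (\<lambda>i. Y i w)) (\<lambda>(\<alpha>, g). g \<in> H)
            (alphahat w, ghat w)"
  shows "risk M X (\<lambda>w x. x \<bullet> alphahat w + ghat w x - fstar x)
    \<le> (INF (\<alpha>, f) \<in> UNIV \<times> H.
          risk M X (\<lambda>w x. x \<bullet> \<alpha> + f x - fstar x) + ennreal (lam * (hilbert_norm ip f)\<^sup>2))
      + ennreal (\<sigma>\<^sup>2) * (ennreal (real CARD('d) / real CARD('n))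
          + (kernel_complexity CARD('n) \<mu> lam)\<^sup>2 / ennreal lam)"
proof -
  interpret random_design M S \<rho> fstar \<sigma> X Y \<epsilon> by (rule model)
  interpret R: rkhs S K H ip by (rule rkhs)
  let ?n = "real CARD('n)"
  let ?c = "?n * lam"
  have c: "?c > 0" using lam by simp
  define A where "A i k w = axis k 1 $ i - residual_matrix ?c K (\<lambda>i. X i w) i k" for i k w
  define b where "b i w = residual ?c K (\<lambda>i. X i w) (\<lambda>i. fstar (X i w)) i" for i w
  define V where "V = ennreal (\<sigma>\<^sup>2) * (ennreal (real CARD('d) / ?n)
          + (kernel_complexity CARD('n) \<mu> lam)\<^sup>2 / ennreal lam)"
  define T where "T = ennreal (real CARD('d)) + (\<Sum>j. ennreal (min lam (\<mu> j))) / ennreal lam"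
  have B_meas: "(\<lambda>w. residual_matrix ?c K (\<lambda>i. X i w) i k) \<in> borel_measurable design_algebra" for i k
    by (rule residual_matrix_measurable[OF continuous X_measurable_design])
  have A_meas: "A i k \<in> borel_measurable design_algebra" for i k
    unfolding A_def using B_meas by simp
  have b_meas: "b i \<in> borel_measurable design_algebra" for i
    unfolding b_def residual_def
    by (intro borel_measurable_sum borel_measurable_times B_meas fstar_X_measurable X_measurable_design)
  have A_bound: "AE w in M. \<bar>A i k w\<bar> \<le> 1" for i k
    unfolding A_def by (rule AE_smoother_bounds(2)[OF rkhs c])
  have n_inverse: "ennreal (1 / ?n) * ennreal ?n = 1"
    by (simp flip: ennreal_mult)
  have trace: "(\<Sum>i\<in>UNIV. \<Sum>k\<in>UNIV. \<integral>\<^sup>+ w. ennreal ((A i k w)\<^sup>2) \<partial>M) \<le> T"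
  proof -
    have [measurable]: "A i k \<in> borel_measurable M" for i k
      by (rule measurable_from_subalg[OF subalgebra_design A_meas])
    have "(\<Sum>i\<in>UNIV. \<Sum>k\<in>UNIV. \<integral>\<^sup>+ w. ennreal ((A i k w)\<^sup>2) \<partial>M)
        = (\<integral>\<^sup>+ w. (\<Sum>k\<in>UNIV. \<Sum>i\<in>UNIV. ennreal ((A i k w)\<^sup>2)) \<partial>M)"
      by (subst sum.swap) (simp add: nn_integral_sum del: sum_ennreal)
    also have "\<dots> \<le> (\<integral>\<^sup>+ w. (\<Sum>k\<in>UNIV. ennreal (1 - residual_matrix ?c K (\<lambda>i. X i w) k k)) \<partial>M)"
    proof (rule nn_integral_mono_AE)
      show "AE w in M. (\<Sum>k\<in>UNIV. \<Sum>i\<in>UNIV. ennreal ((A i k w)\<^sup>2))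
          \<le> (\<Sum>k\<in>UNIV. ennreal (1 - residual_matrix ?c K (\<lambda>i. X i w) k k))"
        using AE_smoother_bounds(1)[OF rkhs c]
        by eventually_elim (auto intro!: sum_mono ennreal_leI simp: A_def)
    qed
    also have "\<dots> \<le> T"
      unfolding T_def by (rule expected_trace_le[OF rkhs continuous eigen lam])
    finally show ?thesis .
  qed
  have V_T: "V = ennreal (1 / ?n) * (ennreal (\<sigma>\<^sup>2) * T)"
  proof -
    have "ennreal (1 / ?n) * T = ennreal (real CARD('d) / ?n)
        + (ennreal (1 / ?n) * (\<Sum>j. ennreal (min lam (\<mu> j)))) / ennreal lam"
      by (simp add: T_def distrib_left ennreal_times_divide flip: ennreal_mult)
    then show ?thesis
      by (simp add: V_def kernel_complexity_square mult.left_commute)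
  qed
  have bound: "risk M X (\<lambda>w x. x \<bullet> alphahat w + ghat w x - fstar x)
      \<le> risk M X (\<lambda>w x. x \<bullet> \<alpha> + f x - fstar x) + ennreal (lam * (hilbert_norm ip f)\<^sup>2) + V"
    if f: "f \<in> H" for \<alpha> f
  proof (cases "risk M X (\<lambda>w x. x \<bullet> \<alpha> + f x - fstar x) = \<top>")
    case True
    then show ?thesis by simp
  next
    case False
    let ?J = "risk M X (\<lambda>w x. x \<bullet> \<alpha> + f x - fstar x) + ennreal (lam * (hilbert_norm ip f)\<^sup>2)"
    have bias: "(\<Sum>i\<in>UNIV. \<integral>\<^sup>+ w. ennreal ((b i w)\<^sup>2) \<partial>M) \<le> ennreal ?n * ?J"
      unfolding b_def by (rule bias_le_approximation_error[OF rkhs continuous lam f])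
    have b_int: "integrable M (\<lambda>w. (b i w)\<^sup>2)" for i
    proof (rule integrableI_bounded)
      show "(\<lambda>w. (b i w)\<^sup>2) \<in> borel_measurable M"
        using measurable_from_subalg[OF subalgebra_design b_meas[of i]] by simp
      have "(\<integral>\<^sup>+ w. ennreal ((b i w)\<^sup>2) \<partial>M) \<le> (\<Sum>i\<in>UNIV. \<integral>\<^sup>+ w. ennreal ((b i w)\<^sup>2) \<partial>M)"
        by (rule member_le_sum) auto
      also have "\<dots> \<le> ennreal ?n * ?J" by (rule bias)
      also have "\<dots> < \<infinity>"
        using False by (simp add: ennreal_mult_less_top less_top)
      finally show "(\<integral>\<^sup>+ w. ennreal (norm ((b i w)\<^sup>2)) \<partial>M) < \<infinity>" by simp
    qed
    have error: "(\<integral>\<^sup>+ w. ennreal ((X i w \<bullet> alphahat w + ghat w (X i w) - fstar (X i w))\<^sup>2) \<partial>M)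
        = (\<integral>\<^sup>+ w. ennreal ((b i w)\<^sup>2) \<partial>M) + ennreal (\<sigma>\<^sup>2) * (\<Sum>k\<in>UNIV. \<integral>\<^sup>+ w. ennreal ((A i k w)\<^sup>2) \<partial>M)" for i
    proof -
      have "(\<integral>\<^sup>+ w. ennreal ((X i w \<bullet> alphahat w + ghat w (X i w) - fstar (X i w))\<^sup>2) \<partial>M)
          = (\<integral>\<^sup>+ w. ennreal (((\<Sum>k\<in>UNIV. A i k w * \<epsilon> k w) - b i w)\<^sup>2) \<partial>M)"
      proof (rule nn_integral_cong_AE)
        show "AE w in M. ennreal ((X i w \<bullet> alphahat w + ghat w (X i w) - fstar (X i w))\<^sup>2)
            = ennreal (((\<Sum>k\<in>UNIV. A i k w * \<epsilon> k w) - b i w)\<^sup>2)"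
          using AE_fitted_error[OF rkhs lam estimator] by eventually_elim (simp add: A_def b_def)
      qed
      also have "\<dots> = (\<integral>\<^sup>+ w. ennreal ((b i w)\<^sup>2) \<partial>M) + ennreal (\<sigma>\<^sup>2) * (\<Sum>k\<in>UNIV. \<integral>\<^sup>+ w. ennreal ((A i k w)\<^sup>2) \<partial>M)"
        by (rule nn_integral_smoother_square[OF b_meas b_int A_meas A_bound])
      finally show ?thesis .
    qed
    have "risk M X (\<lambda>w x. x \<bullet> alphahat w + ghat w x - fstar x)
        = ennreal (1 / ?n) * ((\<Sum>i\<in>UNIV. \<integral>\<^sup>+ w. ennreal ((b i w)\<^sup>2) \<partial>M)
          + ennreal (\<sigma>\<^sup>2) * (\<Sum>i\<in>UNIV. \<Sum>k\<in>UNIV. \<integral>\<^sup>+ w. ennreal ((A i k w)\<^sup>2) \<partial>M))"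
      by (simp add: risk_def error sum.distrib sum_distrib_left)
    also have "\<dots> \<le> ennreal (1 / ?n) * (ennreal ?n * ?J + ennreal (\<sigma>\<^sup>2) * T)"
      by (intro mult_left_mono add_mono bias trace) auto
    also have "\<dots> = ?J + V"
      by (simp add: distrib_left V_T n_inverse flip: mult.assoc)
    finally show ?thesis .
  qed
  show ?thesis
    unfolding V_def[symmetric]
  proof (cases "V = \<top>")
    case False
    have "risk M X (\<lambda>w x. x \<bullet> alphahat w + ghat w x - fstar x) - V
      \<le> (INF (\<alpha>, f) \<in> UNIV \<times> H.
          risk M X (\<lambda>w x. x \<bullet> \<alpha> + f x - fstar x) + ennreal (lam * (hilbert_norm ip f)\<^sup>2))"
    proof (rule INF_greatest, clarify)
      fix \<alpha> :: "real^'d" and f assume "f \<in> H"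
      from bound[OF this, of \<alpha>] False
      show "risk M X (\<lambda>w x. x \<bullet> alphahat w + ghat w x - fstar x) - V
        \<le> risk M X (\<lambda>w x. x \<bullet> \<alpha> + f x - fstar x) + ennreal (lam * (hilbert_norm ip f)\<^sup>2)"
        by (subst ennreal_minus_le_iff) (auto simp: add_ac)
    qed
    with False show "risk M X (\<lambda>w x. x \<bullet> alphahat w + ghat w x - fstar x)
      \<le> (INF (\<alpha>, f) \<in> UNIV \<times> H.
          risk M X (\<lambda>w x. x \<bullet> \<alpha> + f x - fstar x) + ennreal (lam * (hilbert_norm ip f)\<^sup>2)) + V"
      by (subst (asm) ennreal_minus_le_iff) (auto simp: add_ac)
  qed simp
qed

end
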